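(* Let $(u_j)_j\subset L^1([0,T];\mathbb{R}^k)$ be a bounded sequence and let $(\tilde v_j,\tilde u_j)\in L^\infty([0,S_j];[0,1]\times\mathbb{R}^k)$ be the corresponding normalized sequence of vertical relaxations, with time functions $\tilde t_j:[0,S_j]\to[0,T]$. Let $\nu_s$, $s\in[0,S]$, be the Young measure generated by $(\tilde v_j,\tilde u_j)$ and let $\tilde t:[0,S]\to[0,T]$ be the corresponding (limit) time function. Write points in the support of $\nu_s$ as $(a,b)$ with $a\in\mathbb{R}^k$ the $\tilde u$-component and $b\in[0,1]$ the $\tilde v$-component, and put $\rho(s):=\int(|a|+|b|)\,d\nu_s(a,b)$. Define $\sigma:=\tilde t_\star(\rho\,ds)$, the pushforward under $\tilde t$ of the measure $\rho(s)\,ds$ on $[0,S]$, and define $\mu_t$ to be such that for any $g\in C([0,T])$ and $w\in C(\gamma\mathbb{R}^k)$ $$\int_{[0,T]}g(t)\,d\sigma(t)=\int_{[0,S]}\rho(s)\,g(\tilde t(s))\,ds,$$ $$\int_{\gamma\mathbb{R}^k}w(y)\,d\mu_t(y)=\begin{cases}\displaystyle\int\frac{1}{\rho(\tilde t^{-1}(t))}\,w(a/b)\,(b+|a|)\,d\nu_{\tilde t^{-1}(t)}(a,b)&\text{if }\tilde t^{-1}(t)\text{ is a point},\\[2mm]\displaystyle\frac{1}{|\tilde t^{-1}(t)|}\int_{\tilde t^{-1}(t)}\frac1{\rho(s)}\int w(a/b)\,(b+|a|)\,d\nu_s(a,b)\,ds&\text{if }\tilde t^{-1}(t)\text{ is an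 interval},\end{cases}$$ where the inner integrals are over $\mathbb{R}^{k+1}$ and $w(a/0):=\lim_{b\searrow0}w(a/b)$. Then $(u_j)_j$ generates the DiPerna-Majda measure $(\sigma,\mu_t)$.
   Context: Normalized vertical relaxation of $u\in L^1([0,T];\mathbb{R}^k)$: a triple $(\tilde t,\tilde v,\tilde u)$ on an interval $[0,S]$ with $\tilde t$ Lipschitz, $\tilde t'=\tilde v\ge0$ a.e., $\tilde t(0)=0$, $\tilde t(S)=T$, $\tilde u(s)=u(\tilde t(s))\tilde v(s)$ for a.e. $s$, and $\max(\tilde v(s),|\tilde u(s)|)=1$ for a.e. $s$. For the sequence it is understood that $S_j\to S$, that $\tilde v_j,\tilde u_j$ are extended by $0$ beyond $S_j$ (and $\tilde t_j$ by the constant $T$), that $\tilde t_j\to\tilde t$ uniformly on $[0,S]$, and that $(\tilde v_j,\tilde u_j)$ generates $\nu_s$, meaning $\int_0^S\varphi(s,\tilde v_j(s),\tilde u_j(s))\,ds\to\int_0^S\int\varphi(s,b,a)\,d\nu_s(a,b)\,ds$ for all $\varphi\in C_c([0,S]\times\mathbb{R}^{k+1})$. Then $\tilde t$ is monotone and surjective, so each $\tilde t^{-1}(t)$ is a point or an interval. $\gamma\mathbb{R}^k$ denotes the compactification of $\mathbb{R}^k$ obtained by adding infinite directions (one point at infinity for each $u\in\mathbb{S}^{k-1}$, the limit of $\lambda u$, $\lambda\to\infty$); it is homeomorphic to the closed unit ball. A DiPerna-Majda measure on $[0,T]$ consists of a positive Radon measure $\sigma\in M([0,T])$ and a $\sigma$-measurable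 family of Radon measures $\mu_t\in M(\gamma\mathbb{R}^k)$. It is generated by a bounded sequence $(u_j)\subset L^1([0,T];\mathbb{R}^k)$ (exponent $p=1$) if for all $g\in C([0,T])$ and $w\in C(\gamma\mathbb{R}^k)$ $$\int_0^Tg(t)\,w(u_j(t))\,(1+|u_j(t)|)\,dt\to\int_0^Tg(t)\int_{\gamma\mathbb{R}^k}w(y)\,d\mu_t(y)\,d\sigma(t).$$ *)

theory Defs
  imports "HOL-Probability.Probability" "HOL-Real_Asymp.Real_Asymp"
begin

typedef ('k::finite) direction = "{u :: real^'k. norm u = 1}"
  morphisms dir_vec Abs_direction
proof -
  have "norm (axis (undefined::'k) (1::real)) = 1" by simp
  then show ?thesis by blast
qed

datatype ('k::finite) gammaR = Fin "real^'k" | Infty "'k direction"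

text \<open>
  The topology is transported from the closed unit ball: \<open>x\<close> is sent to \<open>x / (1 + |x|)\<close>
  and the point at infinity in direction \<open>u\<close> to \<open>u\<close> itself.
\<close>

primrec to_ball :: "'k::finite gammaR \<Rightarrow> real^'k" where
  "to_ball (Fin x) = x /\<^sub>R (1 + norm x)"
| "to_ball (Infty u) = dir_vec u"

lemma norm_dir_vec [simp]: "norm (dir_vec u) = 1"
  using dir_vec by auto

lemma norm_to_ball_Fin: "norm (to_ball (Fin x)) = norm x / (1 + norm x)"
  by (simp add: divide_inverse mult.commute abs_of_nonneg add_nonneg_nonneg)

lemma norm_to_ball_Fin_less: "norm (to_ball (Fin x)) < 1"
  unfolding norm_to_ball_Fin by (simp add: divide_less_eq add_pos_nonneg)

lemma to_ball_Fin_inverse: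
  "x = to_ball (Fin x) /\<^sub>R (1 - norm (to_ball (Fin x)))"
proof -
  have p: "1 + norm x > 0" by (simp add: add_pos_nonneg)
  have "1 - norm (to_ball (Fin x)) = inverse (1 + norm x)"
    unfolding norm_to_ball_Fin using p by (simp add: field_simps)
  then show ?thesis using p by simp
qed

lemma inj_to_ball: "inj to_ball"
proof (rule injI)
  fix x y :: "'k::finite gammaR" assume eq: "to_ball x = to_ball y"
  show "x = y"
  proof (cases x; cases y)
    fix a b assume "x = Fin a" "y = Fin b"
    then show ?thesis using eq to_ball_Fin_inverse[of a] to_ball_Fin_inverse[of b] by metis
  next
    fix a b assume "x = Infty a" "y = Infty b"
    then show ?thesis using eq dir_vec_inject by auto
  next
    fix a b assume "x = Fin a" "y = Infty b"
    then show ?thesis using eq norm_to_ball_Fin_less[of a] by auto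
  next
    fix a b assume "x = Infty a" "y = Fin b"
    then show ?thesis using eq norm_to_ball_Fin_less[of b] by (metis norm_dir_vec order_less_irrefl to_ball.simps(2))
  qed
qed

lemma range_to_ball: "range to_ball = (cball 0 1 :: (real^'k::finite) set)"
proof (intro equalityI subsetI)
  fix z :: "real^'k" assume "z \<in> range to_ball"
  then obtain x where "z = to_ball x" by auto
  then show "z \<in> cball 0 1"
    using norm_to_ball_Fin_less[THEN less_imp_le]
    by (cases x) (auto simp del: to_ball.simps(1))
next
  fix z :: "real^'k" assume z: "z \<in> cball 0 1"
  show "z \<in> range to_ball"
  proof (cases "norm z = 1")
    case True
    then have "z = to_ball (Infty (Abs_direction z))" by (simp add: Abs_direction_inverse)
    then show ?thesis by blast
  next
    case False
    with z have l: "1 - norm z > 0" by simp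
    define x where "x = z /\<^sub>R (1 - norm z)"
    have "1 + norm x = inverse (1 - norm z)"
      using l by (simp add: x_def field_simps)
    then have "to_ball (Fin x) = z" using l by (simp add: x_def)
    then show ?thesis by blast
  qed
qed

instantiation gammaR :: (finite) metric_space
begin

definition dist_gammaR :: "'a gammaR \<Rightarrow> 'a gammaR \<Rightarrow> real" where
  "dist_gammaR x y = dist (to_ball x) (to_ball y)"

definition uniformity_gammaR :: "('a gammaR \<times> 'a gammaR) filter" where
  "uniformity_gammaR = (INF e\<in>{0 <..}. principal {(x, y). dist x y < e})"

definition open_gammaR :: "'a gammaR set \<Rightarrow> bool" where
  "open_gammaR U \<longleftrightarrow> (\<forall>x\<in>U. eventually (\<lambda>(x', y). x' = x \<longrightarrow> y \<in> U) uniformity)"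

instance
proof
  fix x y z :: "'a gammaR"
  show "dist x y = 0 \<longleftrightarrow> x = y"
    using inj_to_ball by (auto simp: dist_gammaR_def dest: injD)
  show "dist x y \<le> dist x z + dist y z"
    unfolding dist_gammaR_def by (rule dist_triangle2)
qed (simp_all add: uniformity_gammaR_def open_gammaR_def)

end

lemma continuous_to_ball: "continuous_on A (to_ball :: 'k::finite gammaR \<Rightarrow> real^'k)"
  unfolding continuous_on_iff dist_gammaR_def by blast

lemma gammaR_homeomorphic_cball:
  "(UNIV :: 'k::finite gammaR set) homeomorphic (cball 0 1 :: (real^'k) set)"
proof -
  have "continuous_on (cball 0 1) (inv to_ball :: real^'k \<Rightarrow> 'k gammaR)"
    unfolding continuous_on_iff dist_gammaR_def range_to_ball[symmetric]
    by (auto simp: f_inv_into_f)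
  then have "homeomorphism UNIV (cball 0 1) (to_ball :: 'k gammaR \<Rightarrow> _) (inv to_ball)"
    unfolding homeomorphism_def range_to_ball[symmetric]
    by (auto simp: continuous_to_ball f_inv_into_f inv_f_f[OF inj_to_ball] image_image)
  then show ?thesis unfolding homeomorphic_def by blast
qed

lemma Infty_is_limit:
  "((\<lambda>r. Fin (r *\<^sub>R dir_vec u)) \<longlongrightarrow> Infty u) at_top"
proof -
  have ev: "\<forall>\<^sub>F r::real in at_top. dist (Fin (r *\<^sub>R dir_vec u)) (Infty u) = 1 / (1 + r)"
    using eventually_ge_at_top[of 0]
  proof eventually_elim
    case (elim r)
    have "to_ball (Fin (r *\<^sub>R dir_vec u)) - dir_vec u = (r / (1 + r) - 1) *\<^sub>R dir_vec u"
      using elim by (simp add: algebra_simps divide_inverse)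
    then have "dist (Fin (r *\<^sub>R dir_vec u)) (Infty u) = \<bar>r / (1 + r) - 1\<bar>"
      unfolding dist_gammaR_def dist_norm by simp
    then show ?case using elim by (simp add: field_simps abs_if)
  qed
  have "((\<lambda>r::real. 1 / (1 + r)) \<longlongrightarrow> 0) at_top" by real_asymp
  with ev have "((\<lambda>r. dist (Fin (r *\<^sub>R dir_vec u)) (Infty u)) \<longlongrightarrow> 0) at_top"
    using tendsto_cong by fastforce
  then show ?thesis by (rule tendsto_dist_iff[THEN iffD2])
qed

lemma homeomorphism_Fin: "\<exists>g. homeomorphism (UNIV :: (real^'k::finite) set) (range Fin) Fin g"
proof -
  define g :: "'k gammaR \<Rightarrow> real^'k" where "g y = to_ball y /\<^sub>R (1 - norm (to_ball y))" for y
  have gF: "g (Fin x) = x" for x unfolding g_def using to_ball_Fin_inverse by metis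
  have c: "continuous_on (UNIV :: (real^'k) set) (\<lambda>x. to_ball (Fin x))"
    by (auto intro!: continuous_intros simp: add_nonneg_eq_0_iff)
  then have "continuous_on (UNIV :: (real^'k) set) Fin"
    unfolding continuous_on_iff dist_gammaR_def by blast
  moreover have "continuous_on (range Fin) g"
    unfolding g_def using norm_to_ball_Fin_less
    by (intro continuous_intros continuous_to_ball) (auto simp: less_le simp del: to_ball.simps)
  ultimately have "homeomorphism UNIV (range Fin) Fin g"
    unfolding homeomorphism_def using gF by (auto simp: image_iff)
  then show ?thesis by blast
qed

definition normalized_vertical_relaxation ::
  "real \<Rightarrow> (real \<Rightarrow> real^'k::finite) \<Rightarrow> real \<Rightarrow> (real \<Rightarrow> real) \<Rightarrow> (real \<Rightarrow> real) \<Rightarrow> (real \<Rightarrow> real^'k) \<Rightarrow> bool"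
where
  "normalized_vertical_relaxation T u S tt v uu \<longleftrightarrow>
     0 \<le> S \<and> (\<exists>L. L-lipschitz_on {0..S} tt) \<and> tt 0 = 0 \<and> tt S = T \<and>
     v \<in> borel_measurable (lebesgue_on {0..S}) \<and> uu \<in> borel_measurable (lebesgue_on {0..S}) \<and>
     (AE s in lebesgue_on {0..S}.
        (tt has_real_derivative v s) (at s within {0..S}) \<and> 0 \<le> v s \<and>
        uu s = v s *\<^sub>R u (tt s) \<and> max (v s) (norm (uu s)) = 1)"

definition extend_by :: "'b \<Rightarrow> real \<Rightarrow> (real \<Rightarrow> 'b) \<Rightarrow> real \<Rightarrow> 'b" where
  "extend_by c S f s = (if s \<le> S then f s else c)"

text \<open>Points of \<open>\<real>\<^sup>k\<^sup>+\<^sup>1\<close> are written \<open>(a, b)\<close> under the measures \<open>\<nu> s\<close>, with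
  \<open>a\<close> the \<open>u\<close>-component and \<open>b\<close> the \<open>v\<close>-component; test functions take \<open>(s, b, a)\<close>.\<close>

definition young_measure :: "real \<Rightarrow> (real \<Rightarrow> ((real^'k::finite) \<times> real) measure) \<Rightarrow> bool" where
  "young_measure S \<nu> \<longleftrightarrow> \<nu> \<in> measurable (lebesgue_on {0..S}) (prob_algebra borel)"

definition generates_young ::
  "real \<Rightarrow> (nat \<Rightarrow> real \<Rightarrow> real) \<Rightarrow> (nat \<Rightarrow> real \<Rightarrow> real^'k::finite)
     \<Rightarrow> (real \<Rightarrow> ((real^'k) \<times> real) measure) \<Rightarrow> bool"
where
  "generates_young S v uu \<nu> \<longleftrightarrow>
     (\<forall>\<phi> :: real \<times> real \<times> (real^'k) \<Rightarrow> real.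
        continuous_on ({0..S} \<times> UNIV) \<phi> \<longrightarrow>
        (\<exists>K. compact K \<and> (\<forall>z \<in> {0..S} \<times> UNIV - K. \<phi> z = 0)) \<longrightarrow>
        (\<lambda>j. LINT s|lebesgue_on {0..S}. \<phi> (s, v j s, uu j s)) \<longlonglongrightarrow>
          (LINT s|lebesgue_on {0..S}. LINT (a, b)|\<nu> s. \<phi> (s, b, a)))"

text \<open>
  A finite Borel measure on a compact metric space is automatically Radon, so \<open>\<mu> t\<close> is only
  required to be a finite Borel measure. ``\<open>\<sigma>\<close>-measurable'' means measurable with respect to the
  \<open>\<sigma>\<close>-completion; accordingly, integrals against \<open>\<sigma>\<close> of functions defined through
  \<open>\<mu>\<close> are taken over \<^term>\<open>completion \<sigma>\<close>.
\<close>

definition radon_family :: "real \<Rightarrow> (real \<Rightarrow> ('k::finite) gammaR measure) \<Rightarrow> bool" where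
  "radon_family T \<mu> \<longleftrightarrow> (\<forall>t\<in>{0..T}. sets (\<mu> t) = sets borel \<and> finite_measure (\<mu> t))"

definition diperna_majda_measure :: "real \<Rightarrow> real measure \<Rightarrow> (real \<Rightarrow> ('k::finite) gammaR measure) \<Rightarrow> bool" where
  "diperna_majda_measure T \<sigma> \<mu> \<longleftrightarrow>
     sets \<sigma> = sets (restrict_space borel {0..T}) \<and> finite_measure \<sigma> \<and>
     radon_family T \<mu> \<and>
     (\<forall>w. continuous_on UNIV w \<longrightarrow> (\<lambda>t. LINT y|\<mu> t. (w y :: real)) \<in> borel_measurable (completion \<sigma>))"

text \<open>The integrability requirement rules out the default value \<open>0\<close> of a divergent
  integral on the right-hand side.\<close>

definition generates_diperna_majda ::
  "real \<Rightarrow> (nat \<Rightarrow> real \<Rightarrow> real^'k::finite) \<Rightarrow> real measure \<Rightarrow> (real \<Rightarrow> 'k gammaR measure) \<Rightarrow> bool"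
where
  "generates_diperna_majda T u \<sigma> \<mu> \<longleftrightarrow>
     diperna_majda_measure T \<sigma> \<mu> \<and>
     (\<forall>(g :: real \<Rightarrow> real) (w :: 'k gammaR \<Rightarrow> real).
        continuous_on {0..T} g \<longrightarrow> continuous_on UNIV w \<longrightarrow>
        integrable (completion \<sigma>) (\<lambda>t. g t * (LINT y|\<mu> t. w y)) \<and>
        (\<lambda>j. LINT t|lebesgue_on {0..T}. g t * w (Fin (u j t)) * (1 + norm (u j t))) \<longlonglongrightarrow>
          (LINT t|completion \<sigma>. g t * (LINT y|\<mu> t. w y)))"

definition rho :: "(real \<Rightarrow> ((real^'k::finite) \<times> real) measure) \<Rightarrow> real \<Rightarrow> real" where
  "rho \<nu> s = (LINT (a, b)|\<nu> s. norm a + \<bar>b\<bar>)"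

definition sigma_of :: "real \<Rightarrow> real \<Rightarrow> (real \<Rightarrow> real) \<Rightarrow> (real \<Rightarrow> ((real^'k::finite) \<times> real) measure) \<Rightarrow> real measure" where
  "sigma_of T S tt \<nu> =
     distr (density (lebesgue_on {0..S}) (\<lambda>s. ennreal (rho \<nu> s))) (restrict_space borel {0..T}) tt"

definition at_quotient :: "('k::finite gammaR \<Rightarrow> real) \<Rightarrow> real^'k \<Rightarrow> real \<Rightarrow> real" where
  "at_quotient w a b =
     (if b = 0 then Lim (at_right 0) (\<lambda>b'. w (Fin (a /\<^sub>R b'))) else w (Fin (a /\<^sub>R b)))"

definition time_fibre :: "real \<Rightarrow> (real \<Rightarrow> real) \<Rightarrow> real \<Rightarrow> real set" where
  "time_fibre S tt t = {s \<in> {0..S}. tt s = t}"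

definition mu_integral ::
  "real \<Rightarrow> (real \<Rightarrow> real) \<Rightarrow> (real \<Rightarrow> ((real^'k::finite) \<times> real) measure) \<Rightarrow> real \<Rightarrow> ('k gammaR \<Rightarrow> real) \<Rightarrow> real"
where
  "mu_integral S tt \<nu> t w =
     (if is_singleton (time_fibre S tt t) then
        (let s = the_elem (time_fibre S tt t)
         in LINT (a, b)|\<nu> s. 1 / rho \<nu> s * at_quotient w a b * (b + norm a))
      else
        1 / measure lebesgue (time_fibre S tt t) *
        (LINT s|lebesgue_on (time_fibre S tt t).
           1 / rho \<nu> s * (LINT (a, b)|\<nu> s. at_quotient w a b * (b + norm a))))"

text \<open>
  The Young measure \<open>\<nu> s\<close> is only determined for almost every \<open>s\<close>, so \<open>\<mu> t\<close> is
  only determined for \<open>\<sigma>\<close>-almost every \<open>t\<close>.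
\<close>

definition is_mu_of ::
  "real \<Rightarrow> real \<Rightarrow> (real \<Rightarrow> real) \<Rightarrow> (real \<Rightarrow> ((real^'k::finite) \<times> real) measure)
     \<Rightarrow> (real \<Rightarrow> 'k gammaR measure) \<Rightarrow> bool"
where
  "is_mu_of T S tt \<nu> \<mu> \<longleftrightarrow>
     radon_family T \<mu> \<and>
     (AE t in sigma_of T S tt \<nu>.
        \<forall>w. continuous_on UNIV w \<longrightarrow> (LINT y|\<mu> t. w y) = mu_integral S tt \<nu> t w)"

end

theory Submission
  imports Defs
begin

text \<open>
  A vertical relaxation reparametrizes the graph of \<open>u\<close> so that time and accumulated variation both
  run at speed at most one. Since \<open>u = uu / v\<close> in the new parameter and \<open>dt = v ds\<close>, the tested energy
  \<open>g(t) w(u) (1 + |u|) dt\<close> becomes \<open>g(t(s)) w(a / b) (b + |a|) ds\<close> with \<open>a = uu s\<close> and \<open>b = v s\<close>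
  (\<open>change_of_time\<close>). The point of the whole construction is that \<open>w(a / b) (b + |a|)\<close>, called
  \<open>homogeneous_lift w\<close> below, extends to a continuous function of \<open>(a, b)\<close> precisely because \<open>w\<close> is
  continuous up to the directions at infinity: concentrations of \<open>u\<close> correspond to \<open>b = 0\<close>, where
  nothing is singular any more. The pairs \<open>(a, b)\<close> are bounded by the normalization, so the Young
  measure passes to the limit in the energy, and uniform convergence of the time functions takes care
  of the factor \<open>g\<close>. The limit is the integral over \<open>[0, S]\<close> of \<open>g(tt s)\<close> times the \<open>\<nu> s\<close>-average of
  the lift (\<open>energy_limit\<close>).

  It remains to recognize this integral as \<open>\<integral> g(t) \<integral> w d\<mu>\<^sub>t d\<sigma>\<close>. Where \<open>tt\<close> is injective this is the
  definition of the pushforward: the factor \<open>1 / \<rho>\<close> in \<open>\<mu>\<^sub>t\<close> cancels the density of \<open>\<sigma>\<close>. The limit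
  time can also stop, on at most countably many intervals. There \<open>\<mu>\<^sub>t\<close> averages the quotients by
  \<open>\<rho>\<close>, whereas the atom of \<open>\<sigma>\<close> at \<open>t\<close> has mass \<open>\<integral> \<rho>\<close>, so the formula would fail for a general
  density. It holds because \<open>\<rho> = 1\<close> on such an interval: the speeds \<open>v\<close> are nonnegative and their
  integral over the interval tends to zero, so \<open>\<nu> s\<close> lives on \<open>b = 0\<close> (\<open>plateau_vertical\<close>), and then
  the normalization \<open>max b |a| = 1\<close>, which is inherited by \<open>\<nu> s\<close> (\<open>AE_\<nu>_unit_pairs\<close>), forces
  \<open>|a| + b = 1\<close> (\<open>AE_plateau\<close>).
\<close>

section \<open>Lipschitz functions with almost everywhere positive derivative\<close>

text \<open>
  The Lipschitz hypothesis serves to make the image of the exceptional set negligible. If \<open>f\<close>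
  decreased from \<open>f x\<close> to \<open>f y\<close>, a level \<open>c\<close> in between could be chosen outside this image;
  at the last point where \<open>f\<close> reaches \<open>c\<close> the derivative would be positive although \<open>f\<close> stays
  below \<open>c\<close> afterwards.
\<close>

lemma lipschitz_pos_deriv_imp_mono_on:
  fixes f :: "real \<Rightarrow> real"
  assumes lip: "L-lipschitz_on {a..b} f" and N: "negligible N"
    and der: "\<And>x. x \<in> {a..b} - N \<Longrightarrow> \<exists>D>0. (f has_real_derivative D) (at x within {a..b})"
  shows "mono_on {a..b} f"
proof (rule mono_onI, rule ccontr)
  fix x y assume xy: "x \<in> {a..b}" "y \<in> {a..b}" "x \<le> y" and "\<not> f x \<le> f y"
  then have lt: "f y < f x" by simp
  have "negligible (f ` (N \<inter> {a..b}))"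
  proof (rule negligible_locally_Lipschitz_image)
    show "negligible (N \<inter> {a..b})" by (rule negligible_subset[OF N]) auto
    fix z assume z: "z \<in> N \<inter> {a..b}"
    have "\<forall>y\<in>N \<inter> {a..b} \<inter> UNIV. norm (f y - f z) \<le> L * norm (y - z)"
      by (intro ballI) (metis IntD1 IntD2 dist_norm lip lipschitz_onD z)
    then show "\<exists>T B. open T \<and> z \<in> T \<and> (\<forall>y\<in>N \<inter> {a..b} \<inter> T. norm (f y - f z) \<le> B * norm (y - z))"
      by (intro exI[of _ UNIV] exI[of _ L]) (use z in auto)
  qed simp
  \<comment> \<open>Almost every level between \<open>f y\<close> and \<open>f x\<close> is attained outside \<open>N\<close> only.\<close>
  moreover have "\<not> negligible {f y<..<f x}"
    using lt by (metis box_real(1) interior_open open_greaterThanLessThan greaterThanLessThan_empty_iff negligible_interval(2) not_le)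
  ultimately obtain c where c: "c \<in> {f y<..<f x}" "c \<notin> f ` (N \<inter> {a..b})"
    by (meson negligible_subset subsetI)
  have cont: "continuous_on {x..y} f"
    using lipschitz_on_continuous_on[OF lip] by (rule continuous_on_subset) (use xy in auto)
  define Z where "Z = {z \<in> {x..y}. c \<le> f z}"
  have "Z = {x..y} \<inter> f -` {c..}" by (auto simp: Z_def)
  then have "closed Z" using continuous_closed_preimage[OF cont closed_atLeastAtMost closed_atLeast] by simp
  have "compact Z"
    using \<open>closed Z\<close> by (auto simp: Z_def compact_eq_bounded_closed intro: bounded_subset[of "{x..y}"])
  moreover have "x \<in> Z" using c xy by (auto simp: Z_def)
  ultimately obtain m where m: "m \<in> Z" "\<And>z. z \<in> Z \<Longrightarrow> z \<le> m"
    using compact_attains_sup[of Z] by blast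
  have my: "m < y" using m(1) c by (auto simp: Z_def less_le)
  have above: "f z < c" if "z \<in> {m<..y}" for z
  proof (rule ccontr)
    assume "\<not> f z < c"
    then have "z \<in> Z" using that m(1) by (auto simp: Z_def)
    then show False using m(2)[of z] that by simp
  qed
  have "f m = c"
  proof (rule ccontr)
    assume "f m \<noteq> c" then have "c < f m" using m by (auto simp: Z_def)
    then obtain z where "m \<le> z" "z \<le> y" "f z = c"
      using IVT2'[of f y c m] c my continuous_on_subset[OF cont, of "{m..y}"] m(1)
      by (auto simp: Z_def)
    then show False using above[of z] \<open>c < f m\<close> by (cases "z = m") auto
  qed
  moreover have "m \<in> {a..b}" using m(1) xy by (auto simp: Z_def)
  ultimately have "m \<in> {a..b} - N" using c by blast
  then obtain D where D: "D > 0" "(f has_real_derivative D) (at m within {a..b})" using der by blast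
  obtain d where d: "d > 0" "\<And>h. 0 < h \<Longrightarrow> m + h \<in> {a..b} \<Longrightarrow> h < d \<Longrightarrow> f m < f (m + h)"
    using has_real_derivative_pos_inc_right[OF D(2,1)] by blast
  define h where "h = min (d / 2) (y - m)"
  have "0 < h" "h < d" "m + h \<le> y" using d my by (auto simp: h_def)
  then have "f m < f (m + h)" "f (m + h) < c"
    using d(2)[of h] above[of "m + h"] xy m by (auto simp: Z_def)
  then show False using \<open>f m = c\<close> by simp
qed

text \<open>Every interval contains a point of positive derivative, so a monotone \<open>f\<close> is nowhere constant.\<close>

lemma lipschitz_pos_deriv_imp_strict_mono_on:
  fixes f :: "real \<Rightarrow> real"
  assumes lip: "L-lipschitz_on {a..b} f" and N: "negligible N"
    and der: "\<And>x. x \<in> {a..b} - N \<Longrightarrow> \<exists>D>0. (f has_real_derivative D) (at x within {a..b})"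
  shows "strict_mono_on {a..b} f"
proof (rule strict_mono_onI)
  fix x y assume xy: "x \<in> {a..b}" "y \<in> {a..b}" "x < y"
  have mono: "mono_on {a..b} f" by (rule lipschitz_pos_deriv_imp_mono_on[OF assms])
  have "\<not> negligible {x<..<y}"
    using xy by (metis box_real(1) greaterThanLessThan_empty_iff negligible_interval(2) not_le)
  then obtain z where z: "z \<in> {x<..<y}" "z \<notin> N" by (meson N negligible_subset subsetI)
  then obtain D where D: "D > 0" "(f has_real_derivative D) (at z within {a..b})" using der[of z] xy by auto
  obtain d where d: "d > 0" "\<And>h. 0 < h \<Longrightarrow> z + h \<in> {a..b} \<Longrightarrow> h < d \<Longrightarrow> f z < f (z + h)"
    using has_real_derivative_pos_inc_right[OF D(2,1)] by blast
  define h where "h = min (d / 2) (y - z)"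
  have h: "0 < h" "h < d" "z + h \<le> y" using d z by (auto simp: h_def)
  have "f x \<le> f z" "f (z + h) \<le> f y" 
    using z xy h by (auto intro!: mono_onD[OF mono])
  moreover have "f z < f (z + h)" using d(2)[of h] h xy z by auto
  ultimately show "f x < f y" by linarith
qed

lemma AE_lebesgue_on_obtain_negligible:
  assumes "AE x in lebesgue_on A. P x" "A \<in> sets lebesgue"
  obtains N where "negligible N" "N \<subseteq> A" "\<And>x. x \<in> A - N \<Longrightarrow> P x"
proof -
  from AE_E3[OF assms(1)] obtain N where "N \<in> null_sets (lebesgue_on A)" "\<And>x. x \<in> A - N \<Longrightarrow> P x"
    by (metis space_lebesgue_on)
  then show ?thesis using assms(2) that by (auto simp: null_sets_restrict_space negligible_iff_null_sets)
qed

section \<open>Change of time in a vertical relaxation\<close>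

locale vertical_relaxation =
  fixes T :: real and u :: "real \<Rightarrow> real^'k::finite" and S :: real
    and t v :: "real \<Rightarrow> real" and uu :: "real \<Rightarrow> real^'k"
  assumes T_pos: "0 < T" and relaxation: "normalized_vertical_relaxation T u S t v uu"
begin

lemma
  shows S_nonneg: "0 \<le> S" and t_0: "t 0 = 0" and t_S: "t S = T"
    and v_measurable: "v \<in> borel_measurable (lebesgue_on {0..S})"
    and uu_measurable: "uu \<in> borel_measurable (lebesgue_on {0..S})"
  using relaxation by (auto simp: normalized_vertical_relaxation_def)

text \<open>
  The speed is strictly positive: \<open>v s = 0\<close> would give \<open>uu s = 0\<close>, against the normalization.
  Hence time never stops before the limit, and \<open>t\<close> is a bijection of \<open>[0, S]\<close> onto \<open>[0, T]\<close>.
\<close>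

lemma AE_normalized:
  "AE s in lebesgue_on {0..S}. (t has_real_derivative v s) (at s within {0..S}) \<and> 0 < v s \<and>
     uu s = v s *\<^sub>R u (t s) \<and> max (v s) (norm (uu s)) = 1"
proof -
  have "AE s in lebesgue_on {0..S}.
        (t has_real_derivative v s) (at s within {0..S}) \<and> 0 \<le> v s \<and>
        uu s = v s *\<^sub>R u (t s) \<and> max (v s) (norm (uu s)) = 1"
    using relaxation by (auto simp: normalized_vertical_relaxation_def)
  then show ?thesis by eventually_elim (auto simp: less_le)
qed

lemma obtain_exceptional_set:
  obtains N where "negligible N" "N \<subseteq> {0..S}"
    "\<And>s. s \<in> {0..S} - N \<Longrightarrow> (t has_real_derivative v s) (at s within {0..S})"
    "\<And>s. s \<in> {0..S} - N \<Longrightarrow> 0 < v s"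
    "\<And>s. s \<in> {0..S} - N \<Longrightarrow> uu s = v s *\<^sub>R u (t s)"
    "\<And>s. s \<in> {0..S} - N \<Longrightarrow> max (v s) (norm (uu s)) = 1"
  using AE_lebesgue_on_obtain_negligible[OF AE_normalized] by (metis lmeasurable_cbox cbox_interval fmeasurableD)

lemma t_lipschitz_ex: "\<exists>L. L-lipschitz_on {0..S} t"
  using relaxation by (auto simp: normalized_vertical_relaxation_def)

lemma t_strict_mono: "strict_mono_on {0..S} t"
proof -
  obtain L where L: "L-lipschitz_on {0..S} t" using t_lipschitz_ex by blast
  obtain N where N: "negligible N" "\<And>s. s \<in> {0..S} - N \<Longrightarrow> (t has_real_derivative v s) (at s within {0..S})"
    "\<And>s. s \<in> {0..S} - N \<Longrightarrow> 0 < v s" using obtain_exceptional_set by metis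
  show ?thesis
    by (rule lipschitz_pos_deriv_imp_strict_mono_on[OF L N(1)]) (use N in blast)
qed

lemma t_le: "x \<in> {0..S} \<Longrightarrow> y \<in> {0..S} \<Longrightarrow> x \<le> y \<Longrightarrow> t x \<le> t y"
  using strict_mono_onD[OF t_strict_mono, of x y] by (cases "x = y") auto

lemma t_inj: "inj_on t {0..S}"
  using t_strict_mono strict_mono_on_imp_inj_on by blast

text \<open>
  The speed is at most one, so \<open>(1 + e) s - t s\<close> has positive derivative for every \<open>e > 0\<close> and is
  therefore increasing.
\<close>

lemma t_1_lipschitz: "1-lipschitz_on {0..S} t"
proof -
  obtain L where L: "L-lipschitz_on {0..S} t" using t_lipschitz_ex by blast
  obtain N where N: "negligible N" "\<And>s. s \<in> {0..S} - N \<Longrightarrow> (t has_real_derivative v s) (at s within {0..S})"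
    "\<And>s. s \<in> {0..S} - N \<Longrightarrow> max (v s) (norm (uu s)) = 1" using obtain_exceptional_set by metis
  have le: "t y - t x \<le> (1 + e) * (y - x)" if xy: "x \<in> {0..S}" "y \<in> {0..S}" "x \<le> y" and e: "0 < e" for x y e
  proof -
    have "mono_on {0..S} (\<lambda>s. (1 + e) * s - t s)"
    proof (rule lipschitz_pos_deriv_imp_mono_on[OF _ N(1)])
      show "(\<bar>1 + e\<bar> * 1 + L)-lipschitz_on {0..S} (\<lambda>s. (1 + e) * s - t s)"
        by (intro lipschitz_intros L)
      fix s assume s: "s \<in> {0..S} - N"
      have "((\<lambda>s. (1 + e) * s - t s) has_real_derivative (1 + e) - v s) (at s within {0..S})"
        using N(2)[OF s] by (auto intro!: derivative_eq_intros)
      moreover have "v s \<le> 1" using N(3)[OF s] by linarith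
      ultimately show "\<exists>D>0. ((\<lambda>s. (1 + e) * s - t s) has_real_derivative D) (at s within {0..S})"
        using e by (intro exI[of _ "(1 + e) - v s"]) auto
    qed
    from mono_onD[OF this xy] show ?thesis by (simp add: algebra_simps)
  qed
  have le1: "t y - t x \<le> y - x" if xy: "x \<in> {0..S}" "y \<in> {0..S}" "x \<le> y" for x y
  proof (rule field_le_epsilon)
    fix e :: real assume e: "0 < e"
    have "t y - t x \<le> (1 + e / (1 + S)) * (y - x)"
      using le[OF xy, of "e / (1 + S)"] e S_nonneg by simp
    also have "\<dots> = (y - x) + e * ((y - x) / (1 + S))" by (simp add: field_simps)
    also have "e * ((y - x) / (1 + S)) \<le> e * 1"
      using xy S_nonneg e by (intro mult_left_mono) auto
    finally show "t y - t x \<le> y - x + e" by simp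
  qed
  show ?thesis
  proof (rule lipschitz_onI)
    fix x y assume "x \<in> {0..S}" "y \<in> {0..S}"
    then show "dist (t x) (t y) \<le> 1 * dist x y"
      using le1[of x y] le1[of y x] t_le[of x y] t_le[of y x]
      by (cases "x \<le> y") (auto simp: dist_real_def)
  qed simp
qed

lemma T_le_S: "T \<le> S"
  using lipschitz_onD[OF t_1_lipschitz, of 0 S] S_nonneg t_0 t_S T_pos by (simp add: dist_real_def)

lemma t_continuous: "continuous_on {0..S} t"
  by (rule lipschitz_on_continuous_on[OF t_1_lipschitz])

lemma t_in: "s \<in> {0..S} \<Longrightarrow> t s \<in> {0..T}"
  using t_le[of 0 s] t_le[of s S] S_nonneg t_0 t_S by simp

lemma t_image: "t ` {0..S} = {0..T}"
proof
  show "t ` {0..S} \<subseteq> {0..T}" using t_in by blast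
  show "{0..T} \<subseteq> t ` {0..S}"
  proof
    fix y assume "y \<in> {0..T}"
    then obtain x where "0 \<le> x" "x \<le> S" "t x = y"
      using IVT'[of t 0 y S] S_nonneg t_continuous t_0 t_S by auto
    then show "y \<in> t ` {0..S}" by auto
  qed
qed

text \<open>
  The substitution rule for injective differentiable functions applies on the set of points where the
  derivative exists; the Lipschitz property makes the image of the complementary null set null.
\<close>

lemma change_of_time:
  fixes f :: "real \<Rightarrow> real"
  assumes f: "integrable (lebesgue_on {0..T}) f"
  shows "integrable (lebesgue_on {0..S}) (\<lambda>s. v s * f (t s))" (is ?int)
    and "(LINT s|lebesgue_on {0..S}. v s * f (t s)) = (LINT r|lebesgue_on {0..T}. f r)" (is ?eq)
proof -
  obtain N where N: "negligible N" "N \<subseteq> {0..S}" "\<And>s. s \<in> {0..S} - N \<Longrightarrow> (t has_real_derivative v s) (at s within {0..S})"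
    "\<And>s. s \<in> {0..S} - N \<Longrightarrow> 0 < v s" using obtain_exceptional_set by metis
  define A where "A = {0..S} - N"
  have A: "A \<in> sets lebesgue" "A \<subseteq> {0..S}"
    unfolding A_def using N(1) by (auto simp: negligible_iff_null_sets)
  have negN: "negligible (t ` N)"
  proof (rule negligible_locally_Lipschitz_image)
    fix z assume z: "z \<in> N"
    have "\<forall>y\<in>N \<inter> UNIV. norm (t y - t z) \<le> 1 * norm (y - z)"
      using z N(2) by (intro ballI) (metis IntD1 subsetD dist_norm t_1_lipschitz lipschitz_onD)
    then show "\<exists>T B. open T \<and> z \<in> T \<and> (\<forall>y\<in>N \<inter> T. norm (t y - t z) \<le> B * norm (y - z))"
      by (intro exI[of _ UNIV] exI[of _ 1]) auto
  qed (use N in auto)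
  have img: "t ` A = {0..T} - t ` N"
    unfolding A_def t_image[symmetric] using t_inj N(2) by (simp add: inj_on_image_set_diff)
  have fT: "f absolutely_integrable_on {0..T}"
    using f by (simp add: set_integrable_def integrable_restrict_space)
  have fA: "f absolutely_integrable_on t ` A"
    unfolding img by (rule set_integrable_subset[OF fT]) (use negN in \<open>auto simp: negligible_iff_null_sets\<close>)
  have cov: "(\<lambda>s. \<bar>v s\<bar> * f (t s)) absolutely_integrable_on A \<and>
      integral A (\<lambda>s. \<bar>v s\<bar> * f (t s)) = integral (t ` A) f"
    by (subst has_absolute_integral_change_of_variables_1'[OF A(1), of t v f])
       (use N(3) A(2) fA in \<open>auto simp: A_def intro: DERIV_subset inj_on_subset[OF t_inj]\<close>)
  have intA: "(\<lambda>s. v s * f (t s)) absolutely_integrable_on A"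
    using cov by (subst set_integrable_cong[OF refl refl, of _ _ "\<lambda>s. \<bar>v s\<bar> * f (t s)"]) (use N(4) in \<open>force simp: A_def\<close>)+
  have spike: "((\<lambda>s. v s * f (t s)) absolutely_integrable_on A) = ((\<lambda>s. v s * f (t s)) absolutely_integrable_on {0..S})"
    by (rule absolutely_integrable_spike_set_eq)
       (use N in \<open>auto simp: A_def intro: negligible_subset[OF N(1)]\<close>)
  have int: "(\<lambda>s. v s * f (t s)) absolutely_integrable_on {0..S}"
    using intA spike by blast
  then show ?int by (simp add: set_integrable_def integrable_restrict_space)
  have "(LINT s|lebesgue_on {0..S}. v s * f (t s)) = integral {0..S} (\<lambda>s. v s * f (t s))"
    using \<open>?int\<close> by (simp add: lebesgue_integral_eq_integral)
  also have "\<dots> = integral A (\<lambda>s. v s * f (t s))"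
    by (rule integral_spike_set) (use N in \<open>auto simp: A_def intro: negligible_subset[OF N(1)]\<close>)
  also have "\<dots> = integral A (\<lambda>s. \<bar>v s\<bar> * f (t s))"
    by (rule Henstock_Kurzweil_Integration.integral_cong) (use N(4) in \<open>force simp: A_def\<close>)
  also have "\<dots> = integral (t ` A) f" using cov by blast
  also have "\<dots> = integral {0..T} f"
    unfolding img by (rule integral_spike_set) (auto intro: negligible_subset[OF negN])
  also have "\<dots> = (LINT r|lebesgue_on {0..T}. f r)"
    using f by (simp add: lebesgue_integral_eq_integral)
  finally show ?eq .
qed

end

section \<open>The homogeneous lift of a function on the compactification\<close>

text \<open>
  A pair \<open>(a, b)\<close> with \<open>b \<ge> 0\<close> stands for the state \<open>u = a / b\<close> carrying the weight \<open>b + |a|\<close>. In the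
  ball model of the compactification the state is \<open>u / (1 + |u|) = a / (b + |a|)\<close>, an expression that
  makes sense for \<open>b = 0\<close> as well and then gives the point at infinity in direction \<open>a\<close>.
\<close>

definition cone_size :: "('a::real_normed_vector \<times> real) \<Rightarrow> real" where
  "cone_size p = norm (fst p) + \<bar>snd p\<bar>"

definition quotient_point :: "((real^'k::finite) \<times> real) \<Rightarrow> 'k gammaR" where
  "quotient_point p = inv to_ball (fst p /\<^sub>R cone_size p)"

definition homogeneous_lift :: "('k::finite gammaR \<Rightarrow> real) \<Rightarrow> ((real^'k) \<times> real) \<Rightarrow> real" where
  "homogeneous_lift w p = cone_size p * w (quotient_point p)"

text \<open>The values that the normalization allows for the pair \<open>(uu s, v s)\<close>.\<close>

definition unit_pairs :: "((real^'k::finite) \<times> real) set" where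
  "unit_pairs = {p. 0 \<le> snd p \<and> max (snd p) (norm (fst p)) = 1}"

lemma cone_size_nonneg [simp]: "0 \<le> cone_size p"
  by (simp add: cone_size_def)

lemma cone_size_eq_0 [simp]: "cone_size p = 0 \<longleftrightarrow> p = 0"
  by (simp add: cone_size_def prod_eq_iff add_nonneg_eq_0_iff)

lemma continuous_cone_size: "continuous_on A cone_size"
  unfolding cone_size_def by (intro continuous_intros)

lemma measurable_cone_size [measurable]: "cone_size \<in> borel_measurable borel"
  by (intro borel_measurable_continuous_onI continuous_cone_size)

lemma cone_size_unit_pairs:
  assumes "p \<in> unit_pairs" shows "1 \<le> cone_size p" "cone_size p \<le> 2"
  using assms by (auto simp: unit_pairs_def cone_size_def max_def split: if_splits)

lemma scaled_in_cball: "fst p /\<^sub>R cone_size p \<in> cball 0 1"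
  for p :: "(real^'k::finite) \<times> real"
proof (cases "p = 0")
  case False
  then have "0 < cone_size p" using cone_size_nonneg[of p] cone_size_eq_0[of p] by linarith
  then show ?thesis by (simp add: divide_inverse[symmetric] mult.commute[of "inverse _"] divide_le_eq) (simp add: cone_size_def)
qed (simp add: cone_size_def)

lemma continuous_inv_to_ball: "continuous_on (cball 0 1) (inv to_ball :: real^'k::finite \<Rightarrow> 'k gammaR)"
  unfolding continuous_on_iff dist_gammaR_def range_to_ball[symmetric]
  by (auto simp: f_inv_into_f)

lemma continuous_quotient_point: "continuous_on (- {0}) (quotient_point :: ((real^'k::finite) \<times> real) \<Rightarrow> 'k gammaR)"
  unfolding quotient_point_def
proof (rule continuous_on_compose2[OF continuous_inv_to_ball])
  show "continuous_on (- {0}) (\<lambda>p :: (real^'k) \<times> real. fst p /\<^sub>R cone_size p)"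
    by (intro continuous_intros continuous_cone_size) simp
qed (use scaled_in_cball in blast)

lemma measurable_quotient_point [measurable]:
  "(quotient_point :: ((real^'k::finite) \<times> real) \<Rightarrow> 'k gammaR) \<in> borel \<rightarrow>\<^sub>M borel"
proof -
  have eq: "quotient_point p = (if p \<in> - {0} then quotient_point p else quotient_point 0)" for p :: "(real^'k) \<times> real"
    by auto
  have [simp]: "{p :: (real^'k) \<times> real. p \<noteq> 0} = - {0}" by auto
  show ?thesis
    by (subst eq[abs_def], rule measurable_If_restrict_space_iff[THEN iffD2])
       (auto intro!: borel_measurable_continuous_on_restrict continuous_quotient_point)
qed

lemma compact_gammaR: "compact (UNIV :: 'k::finite gammaR set)"
  using homeomorphic_compactness[OF gammaR_homeomorphic_cball] by simp

lemma continuous_gammaR_bounded: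
  fixes w :: "'k::finite gammaR \<Rightarrow> real"
  assumes "continuous_on UNIV w"
  obtains C where "0 \<le> C" "\<And>y. \<bar>w y\<bar> \<le> C"
proof -
  have "bounded (w ` UNIV)" using compact_continuous_image[OF assms compact_gammaR] compact_imp_bounded by blast
  then obtain C where "\<And>y. \<bar>w y\<bar> \<le> C" by (auto simp: bounded_iff)
  then show ?thesis using that[of C] abs_ge_zero order_trans by blast
qed

lemma homogeneous_lift_bound:
  assumes "\<And>y. \<bar>w y\<bar> \<le> C"
  shows "\<bar>homogeneous_lift w p\<bar> \<le> C * cone_size p"
  using mult_left_mono[OF assms[of "quotient_point p"] cone_size_nonneg[of p]]
  by (simp add: homogeneous_lift_def abs_mult mult.commute)

lemma homogeneous_lift_0 [simp]: "homogeneous_lift w 0 = 0"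
  by (simp add: homogeneous_lift_def)

text \<open>
  The quotient point has no limit at the origin, but it enters through the bounded factor \<open>w\<close> only,
  and the weight tends to zero there.
\<close>

lemma continuous_homogeneous_lift:
  fixes w :: "'k::finite gammaR \<Rightarrow> real"
  assumes w: "continuous_on UNIV w"
  shows "continuous_on UNIV (homogeneous_lift w)"
proof -
  obtain C where C: "0 \<le> C" "\<And>y. \<bar>w y\<bar> \<le> C" using continuous_gammaR_bounded[OF w] by blast
  have "continuous_on (- {0}) (homogeneous_lift w)"
    unfolding homogeneous_lift_def
    by (intro continuous_intros continuous_cone_size continuous_on_compose2[OF w continuous_quotient_point]) auto
  then have "isCont (homogeneous_lift w) p" if "p \<noteq> 0" for p
    using that by (simp add: continuous_on_eq_continuous_at open_Compl)
  moreover have "isCont (homogeneous_lift w) 0"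
  proof -
    have "isCont cone_size (0 :: (real^'k) \<times> real)"
      using continuous_cone_size continuous_on_eq_continuous_at[OF open_UNIV] by blast
    then have "((\<lambda>p. C * cone_size p) \<longlongrightarrow> C * cone_size (0 :: (real^'k) \<times> real)) (at (0 :: (real^'k) \<times> real))"
      by (intro tendsto_mult tendsto_const isContD)
    then have "((\<lambda>p. C * cone_size p) \<longlongrightarrow> 0) (at (0 :: (real^'k) \<times> real))"
      by (simp add: cone_size_def)
    then have "(homogeneous_lift w \<longlongrightarrow> 0) (at 0)"
      by (rule Lim_null_comparison[rotated]) (use homogeneous_lift_bound[of w C, OF C(2)] in simp)
    then show ?thesis by (simp add: isCont_def)
  qed
  ultimately show ?thesis by (metis continuous_at_imp_continuous_on)
qed

lemma quotient_point_pos: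
  assumes "0 < b"
  shows "quotient_point (a, b) = Fin (a /\<^sub>R b)"
proof -
  have "to_ball (Fin (a /\<^sub>R b)) = a /\<^sub>R cone_size (a, b)"
    using assms by (simp add: cone_size_def divide_simps add_pos_nonneg)
  then show ?thesis
    unfolding quotient_point_def by (metis fst_conv inj_to_ball inv_f_f)
qed

text \<open>
  For \<open>b = 0\<close> and \<open>a \<noteq> 0\<close> the limit defining \<open>w(a / 0)\<close> exists because \<open>a / b'\<close> converges to the point at
  infinity in direction \<open>a\<close>. For \<open>a = 0\<close> and \<open>b = 0\<close> both sides vanish with the weight.
\<close>

lemma homogeneous_lift_at_quotient:
  fixes w :: "'k::finite gammaR \<Rightarrow> real"
  assumes w: "continuous_on UNIV w" and b: "0 \<le> b"
  shows "at_quotient w a b * (b + norm a) = homogeneous_lift w (a, b)"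
proof (cases "b = 0")
  case False
  then show ?thesis using b by (simp add: at_quotient_def homogeneous_lift_def quotient_point_pos cone_size_def mult.commute add.commute)
next
  case True
  show ?thesis
  proof (cases "a = 0")
    case True
    then show ?thesis using \<open>b = 0\<close> by (simp add: homogeneous_lift_def zero_prod_def[symmetric] cone_size_def)
  next
    case False
    then have ne: "(a, 0::real) \<in> - {0}" by (simp add: zero_prod_def)
    have "isCont quotient_point (a, 0::real)"
      using continuous_quotient_point ne by (metis continuous_on_eq_continuous_at open_Compl closed_singleton)
    moreover have "((\<lambda>b'. (a, b')) \<longlongrightarrow> (a, 0::real)) (at_right 0)" by (intro tendsto_intros)
    ultimately have "((\<lambda>b'. quotient_point (a, b')) \<longlongrightarrow> quotient_point (a, 0::real)) (at_right 0)"
      by (rule isCont_tendsto_compose)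
    then have "((\<lambda>b'. w (quotient_point (a, b'))) \<longlongrightarrow> w (quotient_point (a, 0::real))) (at_right 0)"
      using w by (metis UNIV_I continuous_on_eq_continuous_at isCont_tendsto_compose open_UNIV)
    moreover have "\<forall>\<^sub>F b' in at_right (0::real). w (quotient_point (a, b')) = w (Fin (a /\<^sub>R b'))"
      using eventually_at_right_less[of "0::real"] by eventually_elim (simp add: quotient_point_pos)
    ultimately have "((\<lambda>b'. w (Fin (a /\<^sub>R b'))) \<longlongrightarrow> w (quotient_point (a, 0::real))) (at_right 0)"
      by (rule Lim_transform_eventually)
    then have "Lim (at_right 0) (\<lambda>b'. w (Fin (a /\<^sub>R b'))) = w (quotient_point (a, 0::real))"
      by (intro tendsto_Lim) auto
    then show ?thesis using \<open>b = 0\<close> by (simp add: at_quotient_def homogeneous_lift_def cone_size_def)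
  qed
qed

lemma measurable_gammaR_continuous:
  fixes w :: "'k::finite gammaR \<Rightarrow> real"
  shows "continuous_on UNIV w \<Longrightarrow> w \<in> borel_measurable borel"
  by (rule borel_measurable_continuous_onI)

lemma measurable_homogeneous_lift:
  "continuous_on UNIV w \<Longrightarrow> homogeneous_lift w \<in> borel_measurable borel"
  by (intro borel_measurable_continuous_onI continuous_homogeneous_lift)

text \<open>
  Measurability is needed on the whole space, including the pairs with \<open>b < 0\<close>, which carry no mass;
  there \<open>a / b\<close> is also the quotient of the pair \<open>(- a, - b)\<close> with positive second component.
\<close>

lemma measurable_at_quotient:
  fixes w :: "'k::finite gammaR \<Rightarrow> real"
  assumes w: "continuous_on UNIV w"
  shows "(\<lambda>p. at_quotient w (fst p) (snd p) * (snd p + norm (fst p))) \<in> borel_measurable borel"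
proof -
  note [measurable] = measurable_gammaR_continuous[OF w] measurable_homogeneous_lift[OF w]
  have neg: "at_quotient w a b = w (quotient_point (- (a, b)))" if "b < 0" for a :: "real^'k" and b
    using that quotient_point_pos[of "- b" "- a"] by (simp add: at_quotient_def)
  have "(\<lambda>p. at_quotient w (fst p) (snd p) * (snd p + norm (fst p))) =
    (\<lambda>p. if 0 \<le> snd p then homogeneous_lift w p
          else w (quotient_point (- p)) * (snd p + norm (fst p)))"
    by (rule ext) (auto simp: homogeneous_lift_at_quotient[OF w] neg)
  also have "\<dots> \<in> borel_measurable borel"
  proof (rule measurable_If)
    have "snd \<in> borel_measurable (borel :: ((real^'k) \<times> real) measure)"
      by (intro borel_measurable_continuous_onI continuous_intros)
    then show "{p \<in> space (borel :: ((real^'k) \<times> real) measure). 0 \<le> snd p} \<in> sets borel" by measurable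
    have "(\<lambda>p. - p) \<in> (borel :: ((real^'k) \<times> real) measure) \<rightarrow>\<^sub>M borel"
      by (intro borel_measurable_continuous_onI continuous_intros)
    moreover have "(\<lambda>p. snd p + norm (fst p)) \<in> borel_measurable (borel :: ((real^'k) \<times> real) measure)"
      by (intro borel_measurable_continuous_onI continuous_intros)
    ultimately show "(\<lambda>p. w (quotient_point (- p)) * (snd p + norm (fst p))) \<in> borel_measurable borel"
      by measurable
  qed measurable
  finally show ?thesis .
qed

section \<open>Integration on intervals and Young measures\<close>

lemma (in complete_measure) borel_measurable_AE_cong:
  assumes f: "f \<in> borel_measurable M" and eq: "AE x in M. f x = g x"
  shows "g \<in> borel_measurable M"
proof (rule measurableI)
  fix A :: "'b set" assume "A \<in> sets borel"
  then have A: "f -` A \<inter> space M \<in> sets M" using measurable_sets[OF f] by blast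
  have "AE x in M. x \<in> f -` A \<inter> space M \<longleftrightarrow> x \<in> g -` A \<inter> space M"
    using eq by eventually_elim auto
  from in_sets_AE[OF this A] show "g -` A \<inter> space M \<in> sets M" by simp
qed simp

lemma measurable_extend_by:
  fixes f :: "real \<Rightarrow> 'b::real_normed_vector"
  assumes "f \<in> borel_measurable (lebesgue_on {0..A})"
  shows "extend_by c A f \<in> borel_measurable (lebesgue_on {0..B})"
proof -
  have [simp]: "{x. 0 \<le> x \<and> x \<le> A} = {0..A}" by auto
  have "(\<lambda>s. if s \<in> {0..A} then f s else c) \<in> borel_measurable lebesgue"
    using assms by (subst measurable_If_restrict_space_iff) auto
  then have "(\<lambda>s. if s \<in> {0..A} then f s else c) \<in> borel_measurable (lebesgue_on {0..B})"
    by (rule measurable_restrict_space1)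
  then show ?thesis
    by (rule measurable_cong[THEN iffD1, rotated]) (auto simp: extend_by_def)
qed

lemma lebesgue_on_integral_indicator:
  fixes f :: "real \<Rightarrow> real"
  shows "(LINT s|lebesgue_on {a..b}. f s) = (LINT s|lebesgue. indicator {a..b} s * f s)"
  by (subst integral_restrict_space) auto

lemma lebesgue_on_integrable_indicator:
  fixes f :: "real \<Rightarrow> real"
  shows "integrable (lebesgue_on {a..b}) f \<longleftrightarrow> integrable lebesgue (\<lambda>s. indicator {a..b} s * f s)"
  by (subst integrable_restrict_space) auto

lemma lebesgue_on_AE_iff:
  "(AE s in lebesgue_on {a..b}. P s) \<longleftrightarrow> (AE s in lebesgue. s \<in> {a..b} \<longrightarrow> P s)" for a b :: real
  by (subst AE_restrict_space_iff) auto

lemma finite_measure_lebesgue_on_Icc: "finite_measure (lebesgue_on {a..b::real})"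
  by (rule finite_measureI) (simp add: emeasure_restrict_space emeasure_lborel_Icc_eq)

lemma integrable_lebesgue_on_bounded:
  fixes f :: "real \<Rightarrow> real"
  assumes "f \<in> borel_measurable (lebesgue_on {a..b})" "AE s in lebesgue_on {a..b}. \<bar>f s\<bar> \<le> B"
  shows "integrable (lebesgue_on {a..b}) f"
  using finite_measure.integrable_const_bound[OF finite_measure_lebesgue_on_Icc, of f B a b] assms by simp

lemma measurable_indicator_lebesgue_on [measurable]:
  "A \<in> sets borel \<Longrightarrow> (indicator A :: real \<Rightarrow> real) \<in> borel_measurable (lebesgue_on B)"
  by (intro measurable_restrict_space1 borel_measurable_indicator) auto

lemma continuous_measurable_lebesgue_on:
  fixes f :: "real \<Rightarrow> real"
  shows "continuous_on {a..b} f \<Longrightarrow> f \<in> borel_measurable (lebesgue_on {a..b})"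
  by (rule continuous_imp_measurable_on_sets_lebesgue) auto

locale young_family =
  fixes S :: real and \<nu> :: "real \<Rightarrow> ((real^'k::finite) \<times> real) measure"
  assumes young: "young_measure S \<nu>"
begin

abbreviation M where "M \<equiv> lebesgue_on {0..S}"

lemma \<nu>_measurable: "\<nu> \<in> M \<rightarrow>\<^sub>M subprob_algebra borel"
  using young by (auto simp: young_measure_def intro: measurable_prob_algebraD)

lemma
  assumes "s \<in> {0..S}"
  shows prob_space_\<nu>: "prob_space (\<nu> s)" and sets_\<nu>: "sets (\<nu> s) = sets borel"
proof -
  have "\<nu> s \<in> space (prob_algebra borel)"
    using young assms by (auto simp: young_measure_def dest: measurable_space)
  then show "prob_space (\<nu> s)" and "sets (\<nu> s) = sets borel" by (auto simp: space_prob_algebra)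
qed

lemma measurable_\<nu>: "s \<in> {0..S} \<Longrightarrow> H \<in> borel_measurable borel \<Longrightarrow> H \<in> borel_measurable (\<nu> s)"
  using measurable_cong_sets[OF sets_\<nu> refl] by blast

lemma measurable_average:
  fixes H :: "(real^'k) \<times> real \<Rightarrow> real"
  assumes "H \<in> borel_measurable borel"
  shows "(\<lambda>s. LINT p|\<nu> s. H p) \<in> borel_measurable M"
  by (rule measurable_compose[OF \<nu>_measurable integral_measurable_subprob_algebra[OF assms]])

lemma integrable_\<nu>_bounded:
  fixes H :: "(real^'k) \<times> real \<Rightarrow> real"
  assumes "s \<in> {0..S}" "H \<in> borel_measurable borel" "AE p in \<nu> s. \<bar>H p\<bar> \<le> B"
  shows "integrable (\<nu> s) H" "\<bar>LINT p|\<nu> s. H p\<bar> \<le> B"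
proof -
  interpret prob_space "\<nu> s" using prob_space_\<nu>[OF assms(1)] .
  show int: "integrable (\<nu> s) H"
    using measurable_\<nu>[OF assms(1,2)] assms(3) by (intro integrable_const_bound[where B=B]) auto
  have "\<bar>LINT p|\<nu> s. H p\<bar> \<le> (LINT p|\<nu> s. \<bar>H p\<bar>)" by (rule integral_abs_bound)
  also have "\<dots> \<le> (LINT p|\<nu> s. B)" using int assms(3) by (intro integral_mono_AE) auto
  finally show "\<bar>LINT p|\<nu> s. H p\<bar> \<le> B" by (simp add: prob_space)
qed

text \<open>
  The way in which convergence of integrals restricts the support of a Young measure: a nonnegative
  observable with vanishing total average vanishes almost surely wherever the weight is positive.
\<close>

lemma AE_\<nu>_zero_if_average_zero:
  fixes H :: "(real^'k) \<times> real \<Rightarrow> real"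
  assumes H: "H \<in> borel_measurable borel" "\<And>p. 0 \<le> H p"
    and bound: "AE s in M. AE p in \<nu> s. H p \<le> B"
    and \<psi>: "\<psi> \<in> borel_measurable M" "\<And>s. s \<in> {0..S} \<Longrightarrow> 0 \<le> \<psi> s" "\<And>s. s \<in> {0..S} \<Longrightarrow> \<psi> s \<le> C"
    and zero: "(LINT s|M. \<psi> s * (LINT p|\<nu> s. H p)) = 0"
  shows "AE s in M. 0 < \<psi> s \<longrightarrow> (AE p in \<nu> s. H p = 0)"
proof -
  have nn: "0 \<le> (LINT p|\<nu> s. H p)" for s using H(2) by (intro integral_nonneg_AE) auto
  have le: "AE s in M. (LINT p|\<nu> s. H p) \<le> B"
    using bound AE_space
  proof eventually_elim
    case (elim s)
    then have "AE p in \<nu> s. \<bar>H p\<bar> \<le> B" using H(2) by (auto elim!: eventually_mono)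
    from integrable_\<nu>_bounded(2)[OF _ H(1) this] elim show ?case by auto
  qed
  have "integrable M (\<lambda>s. \<psi> s * (LINT p|\<nu> s. H p))"
  proof (rule integrable_lebesgue_on_bounded)
    show "(\<lambda>s. \<psi> s * (LINT p|\<nu> s. H p)) \<in> borel_measurable M"
      using \<psi>(1) measurable_average[OF H(1)] by measurable
    show "AE s in M. \<bar>\<psi> s * (LINT p|\<nu> s. H p)\<bar> \<le> C * B"
      using le AE_space
    proof eventually_elim
      case (elim s)
      then show ?case using \<psi>(2,3)[of s] nn[of s] by (simp add: abs_mult) (intro mult_mono, auto intro: order_trans)
    qed
  qed
  then have "AE s in M. \<psi> s * (LINT p|\<nu> s. H p) = 0"
    using zero \<psi>(2) nn by (subst (asm) integral_nonneg_eq_0_iff_AE) (auto intro!: AE_I2)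
  then show ?thesis
    using bound AE_space
  proof eventually_elim
    case (elim s)
    then have s: "s \<in> {0..S}" by simp
    have b: "AE p in \<nu> s. \<bar>H p\<bar> \<le> B" using elim H(2) by (auto elim!: eventually_mono)
    show ?case
    proof
      assume "0 < \<psi> s"
      then have "(LINT p|\<nu> s. H p) = 0" using elim by auto
      then show "AE p in \<nu> s. H p = 0"
        using integrable_\<nu>_bounded(1)[OF s H(1) b] H(2) by (subst (asm) integral_nonneg_eq_0_iff_AE) auto
    qed
  qed
qed

end

section \<open>Limits along a sequence of vertical relaxations\<close>

locale relaxation_sequence = young_family S \<nu>
  for S :: real and \<nu> :: "real \<Rightarrow> ((real^'k::finite) \<times> real) measure" +
  fixes T :: real and u :: "nat \<Rightarrow> real \<Rightarrow> real^'k" and Sj :: "nat \<Rightarrow> real"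
    and tj vj :: "nat \<Rightarrow> real \<Rightarrow> real" and uj :: "nat \<Rightarrow> real \<Rightarrow> real^'k" and tt :: "real \<Rightarrow> real"
  assumes T_pos: "0 < T"
    and relaxations: "\<And>j. normalized_vertical_relaxation T (u j) (Sj j) (tj j) (vj j) (uj j)"
    and Sj_lim: "Sj \<longlonglongrightarrow> S"
    and tt_lim: "uniform_limit {0..S} (\<lambda>j. extend_by T (Sj j) (tj j)) tt sequentially"
    and generates: "generates_young S (\<lambda>j. extend_by 0 (Sj j) (vj j)) (\<lambda>j. extend_by 0 (Sj j) (uj j)) \<nu>"
begin

sublocale R: vertical_relaxation T "u j" "Sj j" "tj j" "vj j" "uj j" for j
  by unfold_locales (rule T_pos relaxations)+

abbreviation tx :: "nat \<Rightarrow> real \<Rightarrow> real" where "tx j \<equiv> extend_by T (Sj j) (tj j)"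

definition px :: "nat \<Rightarrow> real \<Rightarrow> (real^'k) \<times> real" where
  "px j s = (extend_by 0 (Sj j) (uj j) s, extend_by 0 (Sj j) (vj j) s)"

lemma T_le_S: "T \<le> S"
  by (rule LIMSEQ_le_const[OF Sj_lim]) (use R.T_le_S in blast)

text \<open>
  Past \<open>Sj j\<close> the extended time is constant with the value \<open>T\<close> reached at \<open>Sj j\<close>, so the extension is
  still monotone and nonexpansive. Both properties survive in the limit.
\<close>

lemma tx_increment:
  assumes "0 \<le> x" "x \<le> y"
  shows "tx j x \<le> tx j y" "tx j y - tx j x \<le> y - x"
proof -
  have *: "0 \<le> tj j b - tj j a \<and> tj j b - tj j a \<le> b - a" if "0 \<le> a" "a \<le> b" "b \<le> Sj j" for a b
    using R.t_le[of a j b] lipschitz_onD[OF R.t_1_lipschitz[of j], of a b] that by (simp add: dist_real_def)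
  have "0 \<le> tx j y - tx j x \<and> tx j y - tx j x \<le> y - x"
    using assms *[of x y] *[of x "Sj j"] R.t_S[of j] by (auto simp: extend_by_def)
  then show "tx j x \<le> tx j y" "tx j y - tx j x \<le> y - x" by auto
qed

lemma tx_in: "0 \<le> s \<Longrightarrow> tx j s \<in> {0..T}"
  using R.t_in[of s j] T_pos by (auto simp: extend_by_def)

lemma tx_tendsto: "s \<in> {0..S} \<Longrightarrow> (\<lambda>j. tx j s) \<longlonglongrightarrow> tt s"
  by (rule tendsto_uniform_limitI[OF tt_lim])

lemma tt_in: "s \<in> {0..S} \<Longrightarrow> tt s \<in> {0..T}"
  using LIMSEQ_le_const[OF tx_tendsto, of s 0] LIMSEQ_le_const2[OF tx_tendsto, of s T] tx_in[of s] by auto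

lemma tt_mono: "x \<in> {0..S} \<Longrightarrow> y \<in> {0..S} \<Longrightarrow> x \<le> y \<Longrightarrow> tt x \<le> tt y"
  using tx_increment(1)[of x y] by (intro LIMSEQ_le[OF tx_tendsto tx_tendsto]) auto

lemma tt_lipschitz: "1-lipschitz_on {0..S} tt"
proof (rule lipschitz_onI)
  have le: "tt y - tt x \<le> y - x" if "x \<in> {0..S}" "y \<in> {0..S}" "x \<le> y" for x y
    using tx_increment(2)[of x y] that by (intro LIMSEQ_le_const2[OF tendsto_diff[OF tx_tendsto tx_tendsto]]) auto
  fix x y assume "x \<in> {0..S}" "y \<in> {0..S}"
  then show "dist (tt x) (tt y) \<le> 1 * dist x y"
    using le[of x y] le[of y x] tt_mono[of x y] tt_mono[of y x]
    by (cases "x \<le> y") (auto simp: dist_real_def)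
qed simp

lemma tt_0: "tt 0 = 0"
proof -
  have "tx j 0 = 0" for j using R.S_nonneg[of j] R.t_0[of j] by (simp add: extend_by_def)
  then show ?thesis using tx_tendsto[of 0] T_le_S T_pos LIMSEQ_unique[OF _ tendsto_const[of 0]] by simp
qed

lemma tt_S: "tt S = T"
proof -
  have "\<bar>tx j S - T\<bar> \<le> \<bar>Sj j - S\<bar>" for j
  proof (cases "S \<le> Sj j")
    case True
    then show ?thesis
      using tx_increment[of S "Sj j" j] T_le_S T_pos R.t_S[of j] by (auto simp: extend_by_def)
  qed (simp add: extend_by_def)
  moreover have "(\<lambda>j. \<bar>Sj j - S\<bar>) \<longlonglongrightarrow> 0"
    using Sj_lim by (simp add: LIM_zero_iff tendsto_rabs_zero_iff)
  ultimately have "(\<lambda>j. tx j S - T) \<longlonglongrightarrow> 0"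
    by (intro Lim_null_comparison[of "\<lambda>j. tx j S - T" "\<lambda>j. \<bar>Sj j - S\<bar>"]) auto
  then have "(\<lambda>j. tx j S) \<longlonglongrightarrow> T" by (simp add: LIM_zero_iff)
  then show ?thesis using tx_tendsto[of S] T_le_S T_pos LIMSEQ_unique by auto
qed

lemma px_measurable: "px j \<in> borel_measurable (lebesgue_on {0..B})"
  unfolding px_def
  by (intro borel_measurable_Pair measurable_extend_by R.uu_measurable R.v_measurable)

lemma AE_px: "AE s in lebesgue. 0 \<le> s \<longrightarrow> (if s \<le> Sj j then px j s \<in> unit_pairs else px j s = 0)"
  using R.AE_normalized[of j, unfolded lebesgue_on_AE_iff]
  by eventually_elim (auto simp: px_def extend_by_def unit_pairs_def zero_prod_def)

lemma AE_px_M: "AE s in M. (if s \<le> Sj j then px j s \<in> unit_pairs else px j s = 0)"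
  unfolding lebesgue_on_AE_iff using AE_px[of j] by eventually_elim auto

text \<open>The Young measure is tested with products only, with its arguments in the order of \<open>px\<close>.\<close>

lemma generates_product:
  fixes H :: "(real^'k) \<times> real \<Rightarrow> real"
  assumes \<psi>: "continuous_on {0..S} \<psi>" and H: "continuous_on UNIV H" and supp: "\<And>p. r \<le> norm p \<Longrightarrow> H p = 0"
  shows "(\<lambda>j. LINT s|M. \<psi> s * H (px j s)) \<longlonglongrightarrow> (LINT s|M. \<psi> s * (LINT p|\<nu> s. H p))"
proof -
  define \<phi> :: "real \<times> real \<times> (real^'k) \<Rightarrow> real" where "\<phi> z = \<psi> (fst z) * H (snd (snd z), fst (snd z))" for z
  have "continuous_on ({0..S} \<times> UNIV) \<phi>"
    unfolding \<phi>_def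
    by (intro continuous_intros continuous_on_compose2[OF \<psi>] continuous_on_compose2[OF H]) auto
  moreover have "\<exists>K. compact K \<and> (\<forall>z \<in> {0..S} \<times> UNIV - K. \<phi> z = 0)"
  proof (intro exI conjI ballI)
    show "compact ({0..S} \<times> cball (0 :: real \<times> (real^'k)) r)" by (intro compact_Times) auto
    fix z assume "z \<in> {0..S} \<times> UNIV - {0..S} \<times> cball (0 :: real \<times> (real^'k)) r"
    then have "r \<le> norm (snd (snd z), fst (snd z))" by (auto simp: norm_Pair add.commute)
    then show "\<phi> z = 0" by (simp add: \<phi>_def supp)
  qed
  ultimately have "(\<lambda>j. LINT s|M. \<phi> (s, extend_by 0 (Sj j) (vj j) s, extend_by 0 (Sj j) (uj j) s)) \<longlonglongrightarrow>
          (LINT s|M. LINT (a, b)|\<nu> s. \<phi> (s, b, a))"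
    using generates unfolding generates_young_def by blast
  moreover have "(LINT (a, b)|\<nu> s. \<phi> (s, b, a)) = \<psi> s * (LINT p|\<nu> s. H p)" for s
  proof -
    have "(\<lambda>(a, b). \<phi> (s, b, a)) = (\<lambda>p. \<psi> s * H p)" by (auto simp: \<phi>_def)
    then show ?thesis by simp
  qed
  ultimately show ?thesis by (simp add: \<phi>_def px_def)
qed

text \<open>
  The normalization passes to the Young measure: a test function that vanishes on the normalized pairs
  has integral zero along the sequence, except for the contribution of the extension by \<open>0\<close>
  beyond \<open>Sj j\<close>, whose length \<open>S - Sj j\<close> becomes arbitrarily small.
\<close>

lemma AE_\<nu>_unit_pairs: "AE s in M. AE p in \<nu> s. p \<in> unit_pairs"
proof -
  \<comment> \<open>\<open>d\<close> is continuous and vanishes exactly on the normalized pairs; the second factor of \<open>\<theta> n\<close>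
    makes the support compact, and every point lies inside one of these supports.\<close>
  define d :: "(real^'k) \<times> real \<Rightarrow> real" where "d p = \<bar>max (snd p) (norm (fst p)) - 1\<bar> + max 0 (- snd p)" for p
  define \<theta> :: "nat \<Rightarrow> (real^'k) \<times> real \<Rightarrow> real" where "\<theta> n p = d p * max 0 (real n - norm p)" for n p
  have d_iff: "d p = 0 \<longleftrightarrow> p \<in> unit_pairs" "0 \<le> d p" for p
    by (auto simp: d_def unit_pairs_def add_nonneg_eq_0_iff max_def)
  have cont: "continuous_on UNIV (\<theta> n)" for n
    unfolding \<theta>_def d_def by (intro continuous_intros)
  have meas: "\<theta> n \<in> borel_measurable borel" for n
    using cont by (rule borel_measurable_continuous_onI)
  have nn: "0 \<le> \<theta> n p" for n p using d_iff(2) by (simp add: \<theta>_def)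
  have \<theta>_0: "\<theta> n 0 = n" for n by (simp add: \<theta>_def d_def)
  have \<theta>_unit: "\<theta> n p = 0" if "p \<in> unit_pairs" for n p using that d_iff(1) by (simp add: \<theta>_def)
  have bound: "\<theta> n p \<le> (2 * real n + 1) * real n" for n p
  proof (cases "norm p \<le> n")
    case True
    then have "norm (fst p) \<le> n" "\<bar>snd p\<bar> \<le> n"
      using norm_fst_le[of "fst p" "snd p"] norm_snd_le[of "snd p" "fst p"] by (auto intro: order_trans)
    then have "d p \<le> 2 * n + 1" by (auto simp: d_def max_def)
    then show ?thesis unfolding \<theta>_def by (intro mult_mono) (auto simp: max_def)
  qed (simp add: \<theta>_def max_def)
  have "AE s in M. AE p in \<nu> s. \<theta> n p = 0" for n
  proof -
    have "(\<lambda>j. LINT s|M. 1 * \<theta> n (px j s)) \<longlonglongrightarrow> (LINT s|M. 1 * (LINT p|\<nu> s. \<theta> n p))"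
      by (rule generates_product[where r = n, OF continuous_on_const cont]) (simp add: \<theta>_def)
    moreover have "(\<lambda>j. LINT s|M. 1 * \<theta> n (px j s)) \<longlonglongrightarrow> 0"
    proof (rule Lim_null_comparison)
      show "\<forall>\<^sub>F j in sequentially. norm (LINT s|M. 1 * \<theta> n (px j s)) \<le> n * \<bar>Sj j - S\<bar>"
      proof (intro always_eventually allI)
        fix j
        have "(LINT s|M. 1 * \<theta> n (px j s)) = (LINT s|M. real n * indicator {Sj j<..S} s)"
        proof (rule integral_cong_AE)
          show "AE s in M. 1 * \<theta> n (px j s) = real n * indicator {Sj j<..S} s"
            using AE_px_M[of j] AE_space
            by eventually_elim (auto simp: \<theta>_0 \<theta>_unit split: if_splits)
        qed (use measurable_compose[OF px_measurable meas] in \<open>auto intro!: borel_measurable_times measurable_indicator_lebesgue_on\<close>)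
        also have "\<dots> = n * (LINT s|lebesgue. indicator {0..S} s * indicator {Sj j<..S} s)"
          by (subst lebesgue_on_integral_indicator[symmetric]) (rule integral_mult_right_zero)
        also have "(LINT s|lebesgue. indicator {0..S} s * indicator {Sj j<..S} s) = (LINT s|lebesgue. indicator {Sj j<..S} s :: real)"
          using R.S_nonneg[of j] by (intro Bochner_Integration.integral_cong) (auto simp: indicator_def)
        also have "\<dots> = max 0 (S - Sj j)" by (simp add: max_def)
        finally show "norm (LINT s|M. 1 * \<theta> n (px j s)) \<le> n * \<bar>Sj j - S\<bar>"
          by (auto simp: abs_mult intro!: mult_left_mono)
      qed
      have "(\<lambda>j. n * \<bar>Sj j - S\<bar>) \<longlonglongrightarrow> n * \<bar>S - S\<bar>" by (intro tendsto_intros Sj_lim)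
      then show "(\<lambda>j. n * \<bar>Sj j - S\<bar>) \<longlonglongrightarrow> 0" by simp
    qed
    ultimately have "(LINT s|M. 1 * (LINT p|\<nu> s. \<theta> n p)) = 0" by (rule LIMSEQ_unique)
    from AE_\<nu>_zero_if_average_zero[OF meas nn _ _ _ _ this, of "(2 * real n + 1) * real n" 1] bound
    show ?thesis by simp
  qed
  then have "AE s in M. \<forall>n. AE p in \<nu> s. \<theta> n p = 0" by (subst AE_all_countable) blast
  then show ?thesis
  proof eventually_elim
    case (elim s)
    then have "AE p in \<nu> s. \<forall>n. \<theta> n p = 0" by (subst AE_all_countable) blast
    then show ?case
    proof eventually_elim
      case (elim p)
      obtain n :: nat where "norm p < n" using reals_Archimedean2 by blast
      then show ?case using elim[rule_format, of n] d_iff(1) by (auto simp: \<theta>_def)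
    qed
  qed
qed

lemma norm_unit_pairs: "p \<in> unit_pairs \<Longrightarrow> norm p \<le> 2"
  using norm_Pair_le[of "fst p" "snd p"] by (auto simp: unit_pairs_def max_def split: if_splits)

text \<open>
  All pairs that matter have norm at most two, so a cutoff beyond this radius changes neither side and
  test functions need not have compact support.
\<close>

lemma generates_continuous:
  fixes H :: "(real^'k) \<times> real \<Rightarrow> real"
  assumes \<psi>: "continuous_on {0..S} \<psi>" and H: "continuous_on UNIV H"
  shows "(\<lambda>j. LINT s|M. \<psi> s * H (px j s)) \<longlonglongrightarrow> (LINT s|M. \<psi> s * (LINT p|\<nu> s. H p))"
proof -
  define G where "G p = H p * max 0 (min 1 (3 - norm p))" for p
  have G: "G p = H p" if "p \<in> unit_pairs \<or> p = 0" for p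
    using that norm_unit_pairs[of p] by (auto simp: G_def)
  have contG: "continuous_on UNIV G" unfolding G_def by (intro continuous_intros H)
  note measH = borel_measurable_continuous_onI[OF H] and measG = borel_measurable_continuous_onI[OF contG]
  note meas\<psi> = continuous_measurable_lebesgue_on[OF \<psi>]
  have "(\<lambda>j. LINT s|M. \<psi> s * G (px j s)) \<longlonglongrightarrow> (LINT s|M. \<psi> s * (LINT p|\<nu> s. G p))"
    by (rule generates_product[where r = 3, OF \<psi> contG]) (auto simp: G_def)
  also have "(\<lambda>j. LINT s|M. \<psi> s * G (px j s)) = (\<lambda>j. LINT s|M. \<psi> s * H (px j s))"
  proof (rule ext, rule integral_cong_AE)
    fix j
    show "AE s in M. \<psi> s * G (px j s) = \<psi> s * H (px j s)"
      using AE_px_M[of j] by eventually_elim (auto simp: G split: if_splits)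
  qed (intro borel_measurable_times meas\<psi> measurable_compose[OF px_measurable measH] measurable_compose[OF px_measurable measG])+
  also have "(LINT s|M. \<psi> s * (LINT p|\<nu> s. G p)) = (LINT s|M. \<psi> s * (LINT p|\<nu> s. H p))"
  proof (rule integral_cong_AE)
    show "AE s in M. \<psi> s * (LINT p|\<nu> s. G p) = \<psi> s * (LINT p|\<nu> s. H p)"
      using AE_\<nu>_unit_pairs AE_space
    proof eventually_elim
      case (elim s)
      have "(LINT p|\<nu> s. G p) = (LINT p|\<nu> s. H p)"
        using elim by (intro integral_cong_AE measurable_\<nu> measG measH) (auto elim!: eventually_mono simp: G)
      then show ?case by simp
    qed
  qed (intro borel_measurable_times meas\<psi> measurable_average measG measH)+
  finally show ?thesis .
qed

lemma measurable_snd_px: "(\<lambda>s. \<bar>snd (px j s)\<bar>) \<in> borel_measurable M"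
  by (rule measurable_compose[OF px_measurable])
     (intro borel_measurable_continuous_onI continuous_intros)

text \<open>
  Change of time applied to the indicator of the elapsed time interval: the integral of the speed is
  bounded by the elapsed time.
\<close>

lemma integral_vx_le:
  assumes "0 \<le> c" "c \<le> d" "d \<le> S"
  shows "(LINT s|M. indicator {c..d} s * \<bar>snd (px j s)\<bar>) \<le> tx j d - tx j c"
proof -
  let ?f = "indicator {tx j c..tx j d} :: real \<Rightarrow> real"
  have meas: "(\<lambda>s. indicator {c..d} s * \<bar>snd (px j s)\<bar>) \<in> borel_measurable M"
    by (intro borel_measurable_times measurable_snd_px measurable_indicator_lebesgue_on) auto
  have f: "integrable (lebesgue_on {0..T}) ?f"
    by (rule integrable_lebesgue_on_bounded[where B = 1]) (auto intro: measurable_indicator_lebesgue_on)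
  have le: "0 \<le> tx j c" "tx j c \<le> tx j d" "tx j d \<le> T"
    using tx_increment(1)[of c d j] tx_in[of c j] tx_in[of d j] assms by auto
  have int: "integrable M (\<lambda>s. indicator {c..d} s * \<bar>snd (px j s)\<bar>)"
  proof (rule integrable_lebesgue_on_bounded[OF meas, where B = 1])
    show "AE s in M. \<bar>indicator {c..d} s * \<bar>snd (px j s)\<bar>\<bar> \<le> 1"
      using AE_px_M[of j] by eventually_elim (auto simp: unit_pairs_def indicator_def split: if_splits)
  qed
  have "(LINT s|M. indicator {c..d} s * \<bar>snd (px j s)\<bar>)
      = (LINT s|lebesgue. indicator {0..S} s * (indicator {c..d} s * \<bar>snd (px j s)\<bar>))"
    by (rule lebesgue_on_integral_indicator)
  also have "\<dots> \<le> (LINT s|lebesgue. indicator {0..Sj j} s * (vj j s * ?f (tj j s)))"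
  proof (rule integral_mono_AE)
    show "integrable lebesgue (\<lambda>s. indicator {0..S} s * (indicator {c..d} s * \<bar>snd (px j s)\<bar>))"
      using int by (simp add: lebesgue_on_integrable_indicator)
    show "integrable lebesgue (\<lambda>s. indicator {0..Sj j} s * (vj j s * ?f (tj j s)))"
      using R.change_of_time(1)[OF f, of j] by (simp only: lebesgue_on_integrable_indicator)
    show "AE s in lebesgue. indicator {0..S} s * (indicator {c..d} s * \<bar>snd (px j s)\<bar>)
        \<le> indicator {0..Sj j} s * (vj j s * ?f (tj j s))"
      using R.AE_normalized[of j, unfolded lebesgue_on_AE_iff]
    proof eventually_elim
      case (elim s)
      show ?case
      proof (cases "s \<in> {c..d} \<and> s \<le> Sj j")
        case True
        then have "tj j s \<in> {tx j c..tx j d}"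
          using tx_increment(1)[of c s j] tx_increment(1)[of s d j] assms by (auto simp: extend_by_def[of T "Sj j" "tj j" s])
        then show ?thesis using True assms elim by (auto simp: px_def extend_by_def indicator_def)
      next
        case False
        then show ?thesis using elim by (auto simp: px_def extend_by_def indicator_def)
      qed
    qed
  qed
  also have "\<dots> = (LINT s|lebesgue_on {0..Sj j}. vj j s * ?f (tj j s))"
    by (rule lebesgue_on_integral_indicator[symmetric])
  also have "\<dots> = (LINT r|lebesgue_on {0..T}. ?f r)" by (rule R.change_of_time(2)[OF f])
  also have "\<dots> = (LINT r|lebesgue. indicator {0..T} r * ?f r)" by (rule lebesgue_on_integral_indicator)
  also have "\<dots> = (LINT r|lebesgue. ?f r)"
    using le by (intro Bochner_Integration.integral_cong) (auto simp: indicator_def)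
  also have "\<dots> = tx j d - tx j c" using le by simp
  finally show ?thesis .
qed

text \<open>
  On an interval where the limit time stands still the elapsed times tend to zero. Hence the
  nonnegative speeds tend to zero in mean, and the Young measure sees no time component.
\<close>

lemma plateau_vertical:
  assumes cd: "0 \<le> c" "c < d" "d \<le> S" and plateau: "tt c = tt d"
  shows "AE s in M. s \<in> {c..d} \<longrightarrow> (AE p in \<nu> s. snd p = 0)"
proof -
  \<comment> \<open>A continuous weight that is positive exactly in the interior of the interval.\<close>
  define \<psi> where "\<psi> s = max 0 (min (s - c) (d - s))" for s
  have \<psi>: "continuous_on {0..S} \<psi>" unfolding \<psi>_def by (intro continuous_intros)
  have \<psi>_bounds: "0 \<le> \<psi> s" "\<psi> s \<le> (d - c) * indicator {c..d} s" "\<psi> s \<le> d - c" for s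
    using cd by (auto simp: \<psi>_def indicator_def)
  have H: "continuous_on UNIV (\<lambda>p :: (real^'k) \<times> real. \<bar>snd p\<bar>)" by (intro continuous_intros)
  have "(\<lambda>j. LINT s|M. \<psi> s * \<bar>snd (px j s)\<bar>) \<longlonglongrightarrow> (LINT s|M. \<psi> s * (LINT p|\<nu> s. \<bar>snd p\<bar>))"
    by (rule generates_continuous[OF \<psi> H])
  moreover have "(\<lambda>j. LINT s|M. \<psi> s * \<bar>snd (px j s)\<bar>) \<longlonglongrightarrow> 0"
  proof (rule Lim_null_comparison)
    show "\<forall>\<^sub>F j in sequentially. norm (LINT s|M. \<psi> s * \<bar>snd (px j s)\<bar>) \<le> (d - c) * (tx j d - tx j c)"
    proof (intro always_eventually allI)
      fix j
      have m [measurable]: "(\<lambda>s. \<bar>snd (px j s)\<bar>) \<in> borel_measurable M"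
        by (rule measurable_snd_px)
      have m2 [measurable]: "\<psi> \<in> borel_measurable M" by (rule continuous_measurable_lebesgue_on[OF \<psi>])
      have b: "AE s in M. \<bar>snd (px j s)\<bar> \<le> 1"
        using AE_px_M[of j] by eventually_elim (auto simp: unit_pairs_def split: if_splits)
      have 0: "0 \<le> (LINT s|M. \<psi> s * \<bar>snd (px j s)\<bar>)"
        using \<psi>_bounds(1) by (intro integral_nonneg_AE) auto
      have "(LINT s|M. \<psi> s * \<bar>snd (px j s)\<bar>) \<le> (LINT s|M. (d - c) * (indicator {c..d} s * \<bar>snd (px j s)\<bar>))"
      proof (rule integral_mono_AE)
        show "integrable M (\<lambda>s. \<psi> s * \<bar>snd (px j s)\<bar>)"
        proof (rule integrable_lebesgue_on_bounded)
          show "AE s in M. \<bar>\<psi> s * \<bar>snd (px j s)\<bar>\<bar> \<le> (d - c) * 1"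
            using b
          proof eventually_elim
            case (elim s)
            have "\<psi> s * \<bar>snd (px j s)\<bar> \<le> (d - c) * 1"
              using elim \<psi>_bounds cd by (intro mult_mono) auto
            then show ?case using \<psi>_bounds(1)[of s] by (simp add: abs_mult)
          qed
        qed measurable
        show "integrable M (\<lambda>s. (d - c) * (indicator {c..d} s * \<bar>snd (px j s)\<bar>))"
        proof (rule integrable_lebesgue_on_bounded)
          show "AE s in M. \<bar>(d - c) * (indicator {c..d} s * \<bar>snd (px j s)\<bar>)\<bar> \<le> (d - c) * 1"
            using b by eventually_elim (use cd in \<open>auto simp: abs_mult indicator_def intro!: mult_left_mono\<close>)
        qed measurable
        show "AE s in M. \<psi> s * \<bar>snd (px j s)\<bar> \<le> (d - c) * (indicator {c..d} s * \<bar>snd (px j s)\<bar>)"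
          using \<psi>_bounds(2) by (auto simp: mult.assoc[symmetric] intro!: mult_right_mono)
      qed
      also have "\<dots> = (d - c) * (LINT s|M. indicator {c..d} s * \<bar>snd (px j s)\<bar>)" by simp
      also have "\<dots> \<le> (d - c) * (tx j d - tx j c)"
        using integral_vx_le[of c d j] cd by (intro mult_left_mono) auto
      finally show "norm (LINT s|M. \<psi> s * \<bar>snd (px j s)\<bar>) \<le> (d - c) * (tx j d - tx j c)" using 0 by simp
    qed
    have "(\<lambda>j. (d - c) * (tx j d - tx j c)) \<longlonglongrightarrow> (d - c) * (tt d - tt c)"
      by (intro tendsto_intros tx_tendsto) (use cd in auto)
    then show "(\<lambda>j. (d - c) * (tx j d - tx j c)) \<longlonglongrightarrow> 0" using plateau by simp
  qed
  ultimately have zero: "(LINT s|M. \<psi> s * (LINT p|\<nu> s. \<bar>snd p\<bar>)) = 0" by (rule LIMSEQ_unique)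
  have "AE s in M. 0 < \<psi> s \<longrightarrow> (AE p in \<nu> s. \<bar>snd p\<bar> = 0)"
  proof (rule AE_\<nu>_zero_if_average_zero[OF _ _ _ continuous_measurable_lebesgue_on[OF \<psi>] \<psi>_bounds(1,3) zero])
    show "AE s in M. AE p in \<nu> s. \<bar>snd p\<bar> \<le> 1"
      using AE_\<nu>_unit_pairs
    proof eventually_elim
      case (elim s)
      then show ?case by eventually_elim (auto simp: unit_pairs_def)
    qed
  qed (auto intro!: borel_measurable_continuous_onI H)
  moreover have "AE s in M. s \<noteq> c \<and> s \<noteq> d"
    unfolding lebesgue_on_AE_iff
    using AE_completion[OF AE_lborel_singleton[of c]] AE_completion[OF AE_lborel_singleton[of d]]
    by eventually_elim auto
  ultimately show ?thesis by eventually_elim (auto simp: \<psi>_def)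
qed

text \<open>
  In the new parameter the energy is an integral over \<open>[0, Sj j]\<close> with the factor \<open>g (tj j s)\<close>. Replacing
  the interval by \<open>[0, S]\<close> and the factor by \<open>g (tt s)\<close> costs an error controlled by \<open>|Sj j - S|\<close> and the
  uniform distance of the times, because the lift is bounded on normalized pairs. What remains
  is covered by the Young measure.
\<close>

lemma energy_limit:
  fixes g :: "real \<Rightarrow> real" and w :: "'k gammaR \<Rightarrow> real"
  assumes u: "\<And>j. integrable (lebesgue_on {0..T}) (u j)"
    and g: "continuous_on {0..T} g" and w: "continuous_on UNIV w"
  shows "(\<lambda>j. LINT r|lebesgue_on {0..T}. g r * w (Fin (u j r)) * (1 + norm (u j r))) \<longlonglongrightarrow>
    (LINT s|M. g (tt s) * (LINT p|\<nu> s. homogeneous_lift w p))"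
proof -
  obtain C where C: "0 \<le> C" "\<And>y. \<bar>w y\<bar> \<le> C" using continuous_gammaR_bounded[OF w] by blast
  have "compact (g ` {0..T})" by (intro compact_continuous_image g) auto
  then obtain B where B: "\<And>r. r \<in> {0..T} \<Longrightarrow> \<bar>g r\<bar> \<le> B"
    using compact_imp_bounded by (force simp: bounded_iff)
  have B0: "0 \<le> B" using B[of 0] T_pos by auto
  let ?H = "homogeneous_lift w"
  note H = continuous_homogeneous_lift[OF w]
  note measH = measurable_homogeneous_lift[OF w]
  have measFin: "(\<lambda>x. w (Fin x)) \<in> borel_measurable borel"
    using homeomorphism_Fin[where 'k='k] unfolding homeomorphism_def
    by (intro borel_measurable_continuous_onI continuous_on_compose2[OF w]) auto
  have cont_tt: "continuous_on {0..S} (\<lambda>s. g (tt s))"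
    using tt_in by (intro continuous_on_compose2[OF g lipschitz_on_continuous_on[OF tt_lipschitz]]) auto
  have cont_tj: "continuous_on {0..Sj j} (\<lambda>s. g (tj j s))" for j
    using R.t_in by (intro continuous_on_compose2[OF g R.t_continuous]) auto
  have measg: "g \<in> borel_measurable (lebesgue_on {0..T})" by (rule continuous_measurable_lebesgue_on[OF g])
  have boundH: "AE s in lebesgue. 0 \<le> s \<longrightarrow> \<bar>?H (px j s)\<bar> \<le> C * 2" for j
    using AE_px[of j]
  proof eventually_elim
    case (elim s)
    show ?case
    proof (cases "s \<le> Sj j")
      case True
      show ?thesis
      proof
        assume "0 \<le> s"
        then have "C * cone_size (px j s) \<le> C * 2"
          using elim True C(1) cone_size_unit_pairs(2)[of "px j s"] by (intro mult_left_mono) auto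
        then show "\<bar>?H (px j s)\<bar> \<le> C * 2"
          using homogeneous_lift_bound[of w C, OF C(2), of "px j s"] by linarith
      qed
    qed (use elim C in auto)
  qed
  \<comment> \<open>Both integrands live on the whole line so that integrals over different intervals can be compared.\<close>
  define a where "a j s = indicator {0..Sj j} s * (g (tj j s) * ?H (px j s))" for j s
  define b where "b j s = indicator {0..S} s * (g (tt s) * ?H (px j s))" for j s
  have energy: "(LINT r|lebesgue_on {0..T}. g r * w (Fin (u j r)) * (1 + norm (u j r))) = (LINT s|lebesgue. a j s)" for j
  proof -
    let ?f = "\<lambda>r. g r * w (Fin (u j r)) * (1 + norm (u j r))"
    note mu = borel_measurable_integrable[OF u[of j]]
    have mf: "?f \<in> borel_measurable (lebesgue_on {0..T})"
      using measg measurable_compose[OF mu measFin] mu by measurable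
    have f: "integrable (lebesgue_on {0..T}) ?f"
    proof (rule Bochner_Integration.integrable_bound[OF _ mf])
      show "integrable (lebesgue_on {0..T}) (\<lambda>r. B * C * (1 + norm (u j r)))"
        using u[of j] finite_measure.integrable_const[OF finite_measure_lebesgue_on_Icc[of 0 T], of "1::real"] by auto
      show "AE r in lebesgue_on {0..T}. norm (?f r) \<le> norm (B * C * (1 + norm (u j r)))"
        using AE_space by eventually_elim
          (use B C B0 in \<open>auto simp: abs_mult intro!: mult_right_mono mult_mono\<close>)
    qed
    have "(LINT r|lebesgue_on {0..T}. ?f r) = (LINT s|lebesgue_on {0..Sj j}. vj j s * ?f (tj j s))"
      by (rule R.change_of_time(2)[OF f, symmetric])
    also have "\<dots> = (LINT s|lebesgue_on {0..Sj j}. g (tj j s) * ?H (px j s))"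
    proof (rule integral_cong_AE)
      show "(\<lambda>s. vj j s * ?f (tj j s)) \<in> borel_measurable (lebesgue_on {0..Sj j})"
        using R.change_of_time(1)[OF f, of j] by (rule borel_measurable_integrable)
      show "(\<lambda>s. g (tj j s) * ?H (px j s)) \<in> borel_measurable (lebesgue_on {0..Sj j})"
        by (intro borel_measurable_times continuous_measurable_lebesgue_on cont_tj measurable_compose[OF px_measurable measH])
      show "AE s in lebesgue_on {0..Sj j}. vj j s * ?f (tj j s) = g (tj j s) * ?H (px j s)"
        using R.AE_normalized[of j] AE_space
      proof eventually_elim
        case (elim s)
        then have v: "0 < vj j s" and uu: "uj j s = vj j s *\<^sub>R u j (tj j s)"
          and px: "px j s = (uj j s, vj j s)" by (auto simp: px_def extend_by_def)
        have "quotient_point (px j s) = Fin (u j (tj j s))"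
          using v by (simp add: px quotient_point_pos uu)
        moreover have "cone_size (px j s) = vj j s * (1 + norm (u j (tj j s)))"
          using v by (simp add: px cone_size_def uu algebra_simps)
        ultimately show ?case by (simp add: homogeneous_lift_def)
      qed
    qed
    also have "\<dots> = (LINT s|lebesgue. a j s)" unfolding a_def by (rule lebesgue_on_integral_indicator)
    finally show ?thesis .
  qed
  have int_a: "integrable lebesgue (a j)" for j
    unfolding a_def lebesgue_on_integrable_indicator[symmetric]
  proof (rule integrable_lebesgue_on_bounded)
    show "(\<lambda>s. g (tj j s) * ?H (px j s)) \<in> borel_measurable (lebesgue_on {0..Sj j})"
      by (intro borel_measurable_times continuous_measurable_lebesgue_on cont_tj measurable_compose[OF px_measurable measH])
    show "AE s in lebesgue_on {0..Sj j}. \<bar>g (tj j s) * ?H (px j s)\<bar> \<le> B * (C * 2)"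
      unfolding lebesgue_on_AE_iff using boundH[of j]
      by eventually_elim (use B R.t_in B0 in \<open>auto simp: abs_mult intro!: mult_mono\<close>)
  qed
  have int_b: "integrable lebesgue (b j)" for j
    unfolding b_def lebesgue_on_integrable_indicator[symmetric]
  proof (rule integrable_lebesgue_on_bounded)
    show "(\<lambda>s. g (tt s) * ?H (px j s)) \<in> borel_measurable M"
      by (intro borel_measurable_times continuous_measurable_lebesgue_on cont_tt measurable_compose[OF px_measurable measH])
    show "AE s in M. \<bar>g (tt s) * ?H (px j s)\<bar> \<le> B * (C * 2)"
      unfolding lebesgue_on_AE_iff using boundH[of j]
      by eventually_elim (use B tt_in B0 in \<open>auto simp: abs_mult intro!: mult_mono\<close>)
  qed
  have diff: "\<bar>(LINT s|lebesgue. a j s) - (LINT s|lebesgue. b j s)\<bar> \<le> (C * 2) * (e * S + B * \<bar>Sj j - S\<bar>)"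
    if e: "\<forall>s\<in>{0..S}. \<bar>g (tx j s) - g (tt s)\<bar> \<le> e" for j e
  proof -
    have e0: "0 \<le> e" using e T_le_S T_pos by (meson abs_ge_zero atLeastAtMost_iff dual_order.trans less_imp_le order_refl)
    \<comment> \<open>On \<open>[0, S]\<close> the times differ; on \<open>(S, Sj j]\<close> the second integrand is zero.\<close>
    let ?k = "\<lambda>s. (C * 2) * (e * indicator {0..S} s + B * indicator {S<..Sj j} s)"
    have Ioc: "emeasure lborel {S<..Sj j} < \<infinity>" by (cases "S \<le> Sj j") auto
    have int_k: "integrable lebesgue ?k"
      by (intro integrable_mult_right Bochner_Integration.integrable_add integrable_real_indicator)
         (use Ioc in \<open>auto simp: emeasure_lborel_Icc_eq\<close>)
    have "\<bar>(LINT s|lebesgue. a j s) - (LINT s|lebesgue. b j s)\<bar> = \<bar>LINT s|lebesgue. a j s - b j s\<bar>"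
      by (simp add: int_a int_b)
    also have "\<dots> \<le> (LINT s|lebesgue. \<bar>a j s - b j s\<bar>)" by (rule integral_abs_bound)
    also have "\<dots> \<le> (LINT s|lebesgue. ?k s)"
    proof (rule integral_mono_AE)
      show "integrable lebesgue (\<lambda>s. \<bar>a j s - b j s\<bar>)" using int_a int_b by auto
      show "AE s in lebesgue. \<bar>a j s - b j s\<bar> \<le> ?k s"
        using boundH[of j] AE_px[of j]
      proof eventually_elim
        case (elim s)
        consider "s \<in> {0..S}" "s \<le> Sj j" | "s \<in> {0..S}" "Sj j < s" | "s \<in> {S<..Sj j}" | "s < 0" | "S < s" "Sj j < s"
          by fastforce
        then show ?case
        proof cases
          case 1
          have "\<bar>g (tj j s) - g (tt s)\<bar> \<le> e" using bspec[OF e 1(1)] 1 by (simp add: extend_by_def)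
          then have "\<bar>g (tj j s) - g (tt s)\<bar> * \<bar>?H (px j s)\<bar> \<le> e * (C * 2)"
            using elim 1 e0 by (intro mult_mono) auto
          then show ?thesis using 1 by (simp add: a_def b_def abs_mult[symmetric] algebra_simps)
        next
          case 2
          then have "px j s = 0" using elim by auto
          then show ?thesis using 2 e0 C(1) by (simp add: a_def b_def)
        next
          case 3
          then have "0 \<le> s" "tj j s \<in> {0..T}" using R.t_in[of s j] T_le_S T_pos by auto
          then have "\<bar>g (tj j s)\<bar> * \<bar>?H (px j s)\<bar> \<le> B * (C * 2)"
            using elim B B0 by (intro mult_mono) auto
          then show ?thesis using 3 \<open>0 \<le> s\<close> by (simp add: a_def b_def abs_mult mult_ac)
        next
          case 4
          then show ?thesis using T_le_S T_pos by (simp add: a_def b_def)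
        next
          case 5
          then show ?thesis by (simp add: a_def b_def)
        qed
      qed
    qed (rule int_k)
    also have "(LINT s|lebesgue. ?k s) = (C * 2) * (e * S + B * max 0 (Sj j - S))"
      using T_le_S T_pos by (simp add: max_def)
    also have "\<dots> \<le> (C * 2) * (e * S + B * \<bar>Sj j - S\<bar>)"
      using C(1) B0 by (intro mult_left_mono add_left_mono) auto
    finally show ?thesis .
  qed
  have unif: "uniform_limit {0..S} (\<lambda>j s. g (tx j s)) (\<lambda>s. g (tt s)) sequentially"
    using uniform_limit_compose_uniformly_continuous_on[OF tt_lim compact_uniformly_continuous[OF g]] tx_in
    by auto
  have "(\<lambda>j. (LINT s|lebesgue. a j s) - (LINT s|lebesgue. b j s)) \<longlonglongrightarrow> 0"
  proof (rule tendstoI)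
    fix r :: real assume r: "0 < r"
    define K where "K = (C * 2) * (S + B) + 1"
    have K: "1 \<le> K" using C(1) B0 T_le_S T_pos by (simp add: K_def)
    have "0 < r / K" using r K by simp
    have "\<forall>\<^sub>F j in sequentially. \<forall>s\<in>{0..S}. dist (g (tx j s)) (g (tt s)) < r / K"
      using uniform_limitD[OF unif \<open>0 < r / K\<close>] .
    moreover have "\<forall>\<^sub>F j in sequentially. dist (Sj j) S < r / K"
      using tendstoD[OF Sj_lim \<open>0 < r / K\<close>] .
    ultimately show "\<forall>\<^sub>F j in sequentially. dist ((LINT s|lebesgue. a j s) - (LINT s|lebesgue. b j s)) 0 < r"
    proof eventually_elim
      case (elim j)
      have "\<bar>(LINT s|lebesgue. a j s) - (LINT s|lebesgue. b j s)\<bar> \<le> (C * 2) * (r / K * S + B * \<bar>Sj j - S\<bar>)"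
        using elim(1) by (intro diff) (auto simp: dist_real_def intro: less_imp_le)
      also have "\<dots> \<le> (C * 2) * (r / K * S + B * (r / K))"
        using elim(2) C(1) B0 by (intro mult_left_mono add_left_mono) (auto simp: dist_real_def)
      also have "\<dots> = (K - 1) * (r / K)"
      proof -
        have "(C * 2) * (x * S + B * x) = (K - 1) * x" for x by (simp add: K_def algebra_simps)
        then show ?thesis .
      qed
      also have "\<dots> < K * (r / K)" using \<open>0 < r / K\<close> by (intro mult_strict_right_mono) auto
      also have "\<dots> = r" using K by simp
      finally show ?case by simp
    qed
  qed
  moreover have "(\<lambda>j. LINT s|lebesgue. b j s) \<longlonglongrightarrow> (LINT s|M. g (tt s) * (LINT p|\<nu> s. ?H p))"
    using generates_continuous[OF cont_tt H] unfolding b_def lebesgue_on_integral_indicator[symmetric] .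
  ultimately have "(\<lambda>j. LINT s|lebesgue. a j s) \<longlonglongrightarrow> 0 + (LINT s|M. g (tt s) * (LINT p|\<nu> s. ?H p))"
    using tendsto_add[of "\<lambda>j. (LINT s|lebesgue. a j s) - (LINT s|lebesgue. b j s)" 0 sequentially] by fastforce
  then show ?thesis by (simp add: energy)
qed

end

section \<open>Fibres of the limit time function\<close>

text \<open>All that is needed from the approximating sequence in order to disintegrate the limit along time.\<close>

locale parametrized_young = young_family S \<nu>
  for S :: real and \<nu> :: "real \<Rightarrow> ((real^'k::finite) \<times> real) measure" +
  fixes T :: real and tt :: "real \<Rightarrow> real"
  assumes T_pos: "0 < T" and S_pos: "0 < S"
    and tt_0: "tt 0 = 0" and tt_S: "tt S = T"
    and tt_mono: "\<And>x y. x \<in> {0..S} \<Longrightarrow> y \<in> {0..S} \<Longrightarrow> x \<le> y \<Longrightarrow> tt x \<le> tt y"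
    and tt_continuous: "continuous_on {0..S} tt"
    and AE_unit_pairs: "AE s in M. AE p in \<nu> s. p \<in> unit_pairs"
    and plateau_vertical: "\<And>c d. 0 \<le> c \<Longrightarrow> c < d \<Longrightarrow> d \<le> S \<Longrightarrow> tt c = tt d \<Longrightarrow>
        AE s in M. s \<in> {c..d} \<longrightarrow> (AE p in \<nu> s. snd p = 0)"
begin

abbreviation fibre where "fibre \<equiv> time_fibre S tt"
abbreviation \<sigma> where "\<sigma> \<equiv> sigma_of T S tt \<nu>"
abbreviation \<rho> where "\<rho> \<equiv> rho \<nu>"

text \<open>
  A section of \<open>tt\<close>, which is Borel because it is monotone. On times with a single preimage it is the
  inverse of \<open>tt\<close>; on the countably many plateau values it picks the left end point of the plateau.
\<close>

definition first_time :: "real \<Rightarrow> real" where "first_time t = Inf (fibre t)"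

definition plateau_values :: "real set" where
  "plateau_values = {t \<in> {0..T}. \<not> is_singleton (fibre t)}"

lemma tt_in: "s \<in> {0..S} \<Longrightarrow> tt s \<in> {0..T}"
  using tt_mono[of 0 s] tt_mono[of s S] S_pos tt_0 tt_S by simp

lemma fibre_nonempty: assumes "t \<in> {0..T}" shows "fibre t \<noteq> {}"
  using IVT'[of tt 0 t S] assms tt_0 tt_S S_pos tt_continuous by (auto simp: time_fibre_def)

lemma compact_fibre: "compact (fibre t)"
proof -
  have "fibre t = {0..S} \<inter> tt -` {t}" by (auto simp: time_fibre_def)
  moreover have "closed ({0..S} \<inter> tt -` {t})"
    by (rule continuous_closed_preimage[OF tt_continuous]) auto
  ultimately show ?thesis by (simp add: compact_eq_bounded_closed bounded_Int)
qed

lemma first_time_in: assumes "t \<in> {0..T}" shows "first_time t \<in> fibre t"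
  unfolding first_time_def using fibre_nonempty[OF assms] compact_fibre[of t]
  by (intro closed_contains_Inf) (auto simp: compact_imp_closed bounded_imp_bdd_below compact_imp_bounded)

lemma fibre_interval:
  assumes "x \<in> fibre t" "y \<in> fibre t" "x \<le> z" "z \<le> y"
  shows "z \<in> fibre t"
  using assms tt_mono[of x z] tt_mono[of z y] by (auto simp: time_fibre_def)

lemma first_time_eq:
  assumes "s \<in> {0..S}" "tt s \<notin> plateau_values"
  shows "first_time (tt s) = s"
proof -
  have "s \<in> fibre (tt s)" "first_time (tt s) \<in> fibre (tt s)"
    using assms(1) first_time_in[OF tt_in[OF assms(1)]] by (auto simp: time_fibre_def)
  moreover have "is_singleton (fibre (tt s))" using assms tt_in by (auto simp: plateau_values_def)
  ultimately show ?thesis by (auto simp: is_singleton_def)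
qed

lemma fibre_eq_interval:
  assumes "t \<in> plateau_values"
  obtains c d where "fibre t = {c..d}" "0 \<le> c" "c < d" "d \<le> S" "tt c = t" "tt d = t"
proof -
  have ne: "fibre t \<noteq> {}" using assms fibre_nonempty by (auto simp: plateau_values_def)
  obtain c where c: "c \<in> fibre t" "\<And>x. x \<in> fibre t \<Longrightarrow> c \<le> x"
    using compact_attains_inf[OF compact_fibre ne] by blast
  obtain d where d: "d \<in> fibre t" "\<And>x. x \<in> fibre t \<Longrightarrow> x \<le> d"
    using compact_attains_sup[OF compact_fibre ne] by blast
  have eq: "fibre t = {c..d}" 
  proof (intro equalityI subsetI)
    show "x \<in> fibre t" if "x \<in> {c..d}" for x using fibre_interval[OF c(1) d(1)] that by simp
  qed (use c(2) d(2) in simp)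
  have "c \<noteq> d"
  proof
    assume "c = d"
    then have "fibre t = {c}" using eq by simp
    then show False using assms by (auto simp: plateau_values_def)
  qed
  moreover have "c \<le> d" using c(2)[OF d(1)] .
  ultimately show ?thesis using that[OF eq] c(1) d(1) by (auto simp: time_fibre_def)
qed

text \<open>Plateaus are disjoint intervals with nonempty interior.\<close>

lemma countable_plateau_values: "countable plateau_values"
proof (rule countable_image_inj_on)
  show "countable (fibre ` plateau_values)"
  proof (rule countable_disjoint_nonempty_interior_subsets)
    show "pairwise disjnt (fibre ` plateau_values)"
      by (auto simp: pairwise_def disjnt_def time_fibre_def)
    fix A assume A: "A \<in> fibre ` plateau_values" "interior A = {}"
    then obtain t where t: "t \<in> plateau_values" "A = fibre t" by blast
    obtain c d where "fibre t = {c..d}" "c < d" using fibre_eq_interval[OF t(1)] by blast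
    then show "A = {}" using A(2) t(2) by (simp add: interior_atLeastAtMost_real)
  qed
  show "inj_on fibre plateau_values"
  proof (rule inj_onI)
    fix x y assume "x \<in> plateau_values" "y \<in> plateau_values" "fibre x = fibre y"
    then have "first_time x \<in> fibre x" "first_time x \<in> fibre y"
      using first_time_in[of x] by (auto simp: plateau_values_def)
    then show "x = y" by (auto simp: time_fibre_def)
  qed
qed

lemma first_time_mono: "mono_on {0..T} first_time"
proof (rule mono_onI, rule ccontr)
  fix x y assume xy: "x \<in> {0..T}" "y \<in> {0..T}" "x \<le> y" "\<not> first_time x \<le> first_time y"
  have "first_time x \<in> fibre x" "first_time y \<in> fibre y" using xy first_time_in by auto
  then have "y \<le> x" using tt_mono[of "first_time y" "first_time x"] xy by (auto simp: time_fibre_def)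
  then show False using xy by simp
qed

lemma fibre_subset: "fibre t \<subseteq> {0..S}"
  by (auto simp: time_fibre_def)

lemma fibre_borel: "fibre t \<in> sets borel"
  using compact_fibre compact_imp_closed borel_closed by blast

lemma lebesgue_on_fibre: "lebesgue_on (fibre t) = restrict_space M (fibre t)"
  using fibre_subset[of t] fibre_borel[of t] by (simp add: restrict_restrict_space Int_absorb1)

lemma fibre_sets_M: "fibre t \<in> sets M"
  using fibre_subset[of t] fibre_borel[of t] by (auto simp: sets_restrict_space_iff)

lemma AE_fibre: "AE s in M. P s \<Longrightarrow> AE s in lebesgue_on (fibre t). P s"
  unfolding lebesgue_on_fibre using fibre_sets_M[of t] by (subst AE_restrict_space_iff) (auto elim: eventually_mono)

section \<open>The density and the pushforward measure\<close>

lemma rho_eq: "\<rho> s = (LINT p|\<nu> s. cone_size p)"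
  by (simp add: rho_def cone_size_def case_prod_beta')

lemma AE_M_unit_pairs:
  "AE s in M. s \<in> {0..S} \<and> (AE p in \<nu> s. p \<in> unit_pairs)"
  using AE_unit_pairs AE_space by eventually_elim auto

lemma
  assumes s: "s \<in> {0..S}" and unit: "AE p in \<nu> s. p \<in> unit_pairs"
  shows rho_bounds: "1 \<le> \<rho> s" "\<rho> s \<le> 2"
proof -
  interpret prob_space "\<nu> s" by (rule prob_space_\<nu>[OF s])
  have b: "AE p in \<nu> s. \<bar>cone_size p\<bar> \<le> 2"
    using unit
  proof eventually_elim
    case (elim p)
    then show ?case using cone_size_unit_pairs[of p] by simp
  qed
  have int: "integrable (\<nu> s) cone_size" by (rule integrable_\<nu>_bounded[OF s measurable_cone_size b])
  show "\<rho> s \<le> 2" using integrable_\<nu>_bounded(2)[OF s measurable_cone_size b] by (simp add: rho_eq)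
  have "(LINT p|\<nu> s. 1) \<le> (LINT p|\<nu> s. cone_size p)"
    using unit by (intro integral_mono_AE int) (auto elim!: eventually_mono intro: cone_size_unit_pairs)
  then show "1 \<le> \<rho> s" by (simp add: rho_eq prob_space)
qed

lemma measurable_rho [measurable]: "\<rho> \<in> borel_measurable M"
  unfolding rho_eq[abs_def] by (rule measurable_average) measurable

lemma AE_rho_bounds: "AE s in M. 1 \<le> \<rho> s \<and> \<rho> s \<le> 2"
  using AE_M_unit_pairs by eventually_elim (use rho_bounds in blast)

text \<open>A normalized pair without time component has \<open>|a| = 1\<close>, so its weight \<open>|a| + b\<close> is one.\<close>

lemma AE_plateau:
  assumes "t \<in> plateau_values"
  shows "AE s in lebesgue_on (fibre t). s \<in> {0..S} \<and> (AE p in \<nu> s. p \<in> unit_pairs \<and> cone_size p = 1) \<and> \<rho> s = 1"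
proof -
  obtain c d where cd: "fibre t = {c..d}" "0 \<le> c" "c < d" "d \<le> S" "tt c = t" "tt d = t"
    using fibre_eq_interval[OF assms] by blast
  have "AE s in M. s \<in> {c..d} \<longrightarrow> (AE p in \<nu> s. snd p = 0)"
    using plateau_vertical[of c d] cd by simp
  from AE_fibre[OF this] have "AE s in lebesgue_on (fibre t). s \<in> {c..d} \<longrightarrow> (AE p in \<nu> s. snd p = 0)" .
  then show ?thesis using AE_fibre[OF AE_unit_pairs] AE_space
  proof eventually_elim
    case (elim s)
    then have s: "s \<in> {0..S}" and v: "AE p in \<nu> s. snd p = 0" using cd by auto
    interpret prob_space "\<nu> s" by (rule prob_space_\<nu>[OF s])
    have *: "AE p in \<nu> s. p \<in> unit_pairs \<and> cone_size p = 1"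
      using v elim(2) by eventually_elim (auto simp: unit_pairs_def cone_size_def)
    have "(LINT p|\<nu> s. cone_size p) = (LINT p|\<nu> s. 1)"
      using * by (intro integral_cong_AE measurable_\<nu>[OF s]) (auto elim!: eventually_mono)
    then show ?case using * s by (simp add: rho_eq prob_space)
  qed
qed

lemma tt_measurable: "tt \<in> M \<rightarrow>\<^sub>M restrict_space borel {0..T}"
  by (intro measurable_restrict_space2 continuous_measurable_lebesgue_on tt_continuous) (use tt_in in auto)

lemma sets_sigma: "sets \<sigma> = sets (restrict_space borel {0..T})"
  by (simp add: sigma_of_def)

lemma space_sigma: "space \<sigma> = {0..T}"
  by (simp add: sigma_of_def space_restrict_space)

lemma finite_measure_sigma: "finite_measure \<sigma>"
proof -
  have "emeasure (density M (\<lambda>s. ennreal (\<rho> s))) {0..S} = (\<integral>\<^sup>+s. ennreal (\<rho> s) * indicator {0..S} s \<partial>M)"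
    using sets.top[of M] by (intro emeasure_density) auto
  also have "\<dots> \<le> (\<integral>\<^sup>+s. 2 \<partial>M)"
  proof (rule nn_integral_mono_AE)
    show "AE s in M. ennreal (\<rho> s) * indicator {0..S} s \<le> 2"
      using AE_rho_bounds
    proof eventually_elim
      case (elim s)
      then show ?case using ennreal_leI[of "\<rho> s" 2] by (simp add: indicator_def)
    qed
  qed
  also have "\<dots> < \<infinity>"
    by (simp add: emeasure_restrict_space ennreal_mult_less_top emeasure_lborel_Icc_eq)
  finally have "finite_measure (density M (\<lambda>s. ennreal (\<rho> s)))"
    by (intro finite_measureI) simp
  then show ?thesis unfolding sigma_of_def
    by (rule finite_measure.finite_measure_distr) (simp add: tt_measurable)
qed

lemma AE_sigma_iff:
  assumes "E \<in> sets \<sigma>" "AE s in M. tt s \<notin> E"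
  shows "AE t in \<sigma>. t \<notin> E"
  unfolding sigma_of_def
proof (subst AE_distr_iff)
  show "tt \<in> density M (\<lambda>s. ennreal (\<rho> s)) \<rightarrow>\<^sub>M restrict_space borel {0..T}" using tt_measurable by simp
  have "space \<sigma> - E \<in> sets \<sigma>" using assms(1) by blast
  moreover have "{x \<in> space (restrict_space borel {0..T}). x \<notin> E} = space \<sigma> - E"
    by (auto simp: space_sigma space_restrict_space)
  ultimately show "{x \<in> space (restrict_space borel {0..T}). x \<notin> E} \<in> sets (restrict_space borel {0..T})"
    unfolding sets_sigma by simp
  show "AE s in density M (\<lambda>s. ennreal (\<rho> s)). tt s \<notin> E"
    using assms(2) by (subst AE_density) (auto elim: eventually_mono)
qed

lemma plateau_values_sets: "A \<subseteq> plateau_values \<Longrightarrow> A \<in> sets \<sigma>"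
proof -
  assume A: "A \<subseteq> plateau_values"
  then have "countable A" using countable_plateau_values countable_subset by blast
  then have "(\<Union>t\<in>A. {t}) \<in> sets \<sigma>"
    by (rule sets.countable_UN') (use A in \<open>auto simp: sets_sigma sets_restrict_space_iff plateau_values_def\<close>)
  then show ?thesis by simp
qed

lemma first_time_measurable: "first_time \<in> borel_measurable \<sigma>"
  using borel_measurable_mono_on_fnc[OF first_time_mono] measurable_cong_sets[OF sets_sigma refl] by blast

text \<open>
  Properties known for Lebesgue-almost every parameter \<open>s\<close> transfer to \<open>\<sigma>\<close>-almost every time off the
  plateaus. The exceptional set has to be enlarged to a Borel null set first, because only the preimage
  of a Borel set under \<open>first_time\<close> is known to be measurable for \<open>\<sigma>\<close>.
\<close>

lemma AE_sigma_off_plateaus: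
  assumes "AE s in M. Q s"
  shows "AE t in \<sigma>. t \<in> {0..T} \<and> (t \<notin> plateau_values \<longrightarrow> Q (first_time t))"
proof -
  have "{0..S} \<in> sets lebesgue" by simp
  from AE_lebesgue_on_obtain_negligible[OF assms this]
  obtain N where N: "negligible N" "\<And>s. s \<in> {0..S} - N \<Longrightarrow> Q s" by metis
  then obtain N' where N': "N' \<in> null_sets lborel" "N \<subseteq> N'"
    by (auto simp: negligible_iff_null_sets null_sets_completion_iff2)
  have N'_borel: "N' \<in> sets borel" using N'(1) by (auto simp: null_sets_def)
  define E where "E = (first_time -` N' \<inter> space \<sigma>) - plateau_values"
  have "E \<in> sets \<sigma>"
    unfolding E_def using measurable_sets[OF first_time_measurable N'_borel] plateau_values_sets by blast
  moreover have "AE s in M. tt s \<notin> E"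
  proof -
    have "AE s in lebesgue. s \<notin> N'" using N'(1) AE_not_in AE_completion by blast
    then have "AE s in M. s \<notin> N'" unfolding lebesgue_on_AE_iff by eventually_elim auto
    then show ?thesis using AE_space
    proof eventually_elim
      case (elim s)
      then show ?case using first_time_eq[of s] by (cases "tt s \<in> plateau_values") (auto simp: E_def)
    qed
  qed
  ultimately have "AE t in \<sigma>. t \<notin> E" by (rule AE_sigma_iff)
  then show ?thesis using AE_space
  proof eventually_elim
    case (elim t)
    then have t: "t \<in> {0..T}" by (simp add: space_sigma)
    have "Q (first_time t)" if "t \<notin> plateau_values"
    proof (rule N(2))
      have "first_time t \<in> {0..S}" using first_time_in[OF t] by (auto simp: time_fibre_def)
      then show "first_time t \<in> {0..S} - N" using elim t that N'(2) by (auto simp: E_def space_sigma)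
    qed
    then show ?case using t by blast
  qed
qed

text \<open>
  A function of time prescribed by a function \<open>G\<close> of the parameter off the plateau values and by an
  arbitrary \<open>c\<close> on plateau values. Since \<open>G\<close> is merely Lebesgue measurable, the result is measurable for
  the completion of \<open>\<sigma>\<close> only.
\<close>

definition fibrewise :: "(real \<Rightarrow> real) \<Rightarrow> (real \<Rightarrow> real) \<Rightarrow> real \<Rightarrow> real" where
  "fibrewise c G t = (if t \<in> plateau_values then c t else G (first_time t))"

lemma fibrewise_sigma:
  assumes G: "G \<in> borel_measurable M" "AE s in M. \<bar>G s\<bar> \<le> B" and c: "\<And>t. t \<in> plateau_values \<Longrightarrow> \<bar>c t\<bar> \<le> B"
  shows "fibrewise c G \<in> borel_measurable (completion \<sigma>)"
    and "integrable (completion \<sigma>) (fibrewise c G)"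
    and "(LINT t|completion \<sigma>. fibrewise c G t) = (LINT s|M. \<rho> s * (if tt s \<in> plateau_values then c (tt s) else G s))"
    and "(\<lambda>s. \<rho> s * (if tt s \<in> plateau_values then c (tt s) else G s)) \<in> borel_measurable M"
proof -
  have "(\<lambda>s. if s \<in> {0..S} then G s else 0) \<in> borel_measurable lebesgue"
  proof -
    have [simp]: "{x. 0 \<le> x \<and> x \<le> S} = {0..S}" by auto
    show ?thesis using G(1) by (subst measurable_If_restrict_space_iff) auto
  qed
  then obtain G' where G': "G' \<in> borel_measurable borel" "AE s in lborel. (if s \<in> {0..S} then G s else 0) = G' s"
    using completion_ex_borel_measurable_real[of "\<lambda>s. if s \<in> {0..S} then G s else 0" lborel]
    unfolding measurable_lborel2 by blast
  have eqM: "AE s in M. G s = G' s"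
    unfolding lebesgue_on_AE_iff using AE_completion[OF G'(2)] by eventually_elim auto
  \<comment> \<open>The Borel version \<open>k\<close> agrees with the given function almost everywhere for \<open>\<sigma>\<close>.\<close>
  define k where "k = fibrewise c G'"
  have k_meas: "k \<in> borel_measurable \<sigma>"
  proof (rule measurable_discrete_difference[OF _ countable_plateau_values])
    show "(\<lambda>t. G' (first_time t)) \<in> borel_measurable \<sigma>"
      by (rule measurable_compose[OF first_time_measurable G'(1)])
  qed (use plateau_values_sets in \<open>auto simp: k_def fibrewise_def\<close>)
  have eq: "AE t in \<sigma>. k t = fibrewise c G t"
    using AE_sigma_off_plateaus[OF eqM] by eventually_elim (auto simp: k_def fibrewise_def)
  show meas: "fibrewise c G \<in> borel_measurable (completion \<sigma>)"
    by (rule completion.borel_measurable_AE_cong[OF measurable_completion[OF k_meas] AE_completion[OF eq]])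
  have "AE t in \<sigma>. \<bar>fibrewise c G t\<bar> \<le> B"
    using AE_sigma_off_plateaus[OF G(2)] by eventually_elim (auto simp: fibrewise_def c)
  moreover have "finite_measure (completion \<sigma>)"
    using finite_measure_sigma by (intro finite_measureI) (simp add: finite_measure.emeasure_finite)
  ultimately show int: "integrable (completion \<sigma>) (fibrewise c G)"
    using meas by (intro finite_measure.integrable_const_bound[where B=B]) (auto intro: AE_completion)
  have k_tt: "(\<lambda>s. k (tt s)) \<in> borel_measurable M"
    using measurable_compose[OF tt_measurable, of k borel] k_meas measurable_cong_sets[OF sets_sigma refl] by blast
  have eqs: "AE s in M. \<rho> s * k (tt s) = \<rho> s * (if tt s \<in> plateau_values then c (tt s) else G s)"
    using eqM AE_space by eventually_elim (auto simp: k_def fibrewise_def first_time_eq)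
  have m1: "(\<lambda>s. \<rho> s * k (tt s)) \<in> borel_measurable M" using k_tt by measurable
  have [simp]: "complete_measure M"
  proof
    fix A B assume "B \<subseteq> A" "A \<in> null_sets M"
    then have "A \<subseteq> {0..S}" "B \<in> null_sets lebesgue"
      by (auto simp: null_sets_restrict_space intro: null_sets_completion_subset)
    then show "B \<in> sets M" using \<open>B \<subseteq> A\<close> by (auto simp: sets_restrict_space_iff)
  qed
  show m2: "(\<lambda>s. \<rho> s * (if tt s \<in> plateau_values then c (tt s) else G s)) \<in> borel_measurable M"
    by (rule complete_measure.borel_measurable_AE_cong[OF _ m1 eqs]) simp
  have "(LINT t|completion \<sigma>. fibrewise c G t) = (LINT t|completion \<sigma>. k t)"
  proof (rule integral_cong_AE[OF meas measurable_completion[OF k_meas]])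
    show "AE t in completion \<sigma>. fibrewise c G t = k t" using AE_completion[OF eq] by eventually_elim simp
  qed
  also have "\<dots> = (LINT t|\<sigma>. k t)" by (rule integral_completion[OF k_meas])
  also have "\<dots> = (LINT s|density M (\<lambda>s. ennreal (\<rho> s)). k (tt s))"
    unfolding sigma_of_def
    by (rule integral_distr) (use tt_measurable k_meas measurable_cong_sets[OF sets_sigma refl] in auto)
  also have "\<dots> = (LINT s|M. \<rho> s * k (tt s))"
    using AE_rho_bounds k_tt by (subst integral_density) (auto elim!: eventually_mono)
  also have "\<dots> = (LINT s|M. \<rho> s * (if tt s \<in> plateau_values then c (tt s) else G s))"
    by (rule integral_cong_AE[OF m1 m2 eqs])
  finally show "(LINT t|completion \<sigma>. fibrewise c G t) = \<dots>" .
qed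

section \<open>Integrals of the angular measures\<close>

definition lift_average :: "('k gammaR \<Rightarrow> real) \<Rightarrow> real \<Rightarrow> real" where
  "lift_average w s = (LINT p|\<nu> s. homogeneous_lift w p)"

definition plateau_average :: "('k gammaR \<Rightarrow> real) \<Rightarrow> real \<Rightarrow> real" where
  "plateau_average w t = 1 / measure lebesgue (fibre t) * (LINT s|lebesgue_on (fibre t). lift_average w s)"

lemma measurable_lift_average: "continuous_on UNIV w \<Longrightarrow> lift_average w \<in> borel_measurable M"
  unfolding lift_average_def by (intro measurable_average measurable_homogeneous_lift)

lemma lift_average_bound:
  assumes s: "s \<in> {0..S}" and unit: "AE p in \<nu> s. p \<in> unit_pairs"
    and w: "continuous_on UNIV w" and C: "\<And>y. \<bar>w y\<bar> \<le> C"
  shows "\<bar>lift_average w s\<bar> \<le> C * 2"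
  unfolding lift_average_def
proof (rule integrable_\<nu>_bounded(2)[OF s measurable_homogeneous_lift[OF w]])
  have "0 \<le> C" using C[of "Fin 0"] by linarith
  show "AE p in \<nu> s. \<bar>homogeneous_lift w p\<bar> \<le> C * 2"
    using unit
  proof eventually_elim
    case (elim p)
    have "C * cone_size p \<le> C * 2"
      using cone_size_unit_pairs(2)[OF elim] \<open>0 \<le> C\<close> by (rule mult_left_mono)
    then show ?case using homogeneous_lift_bound[of w C, OF C, of p] by linarith
  qed
qed

lemma at_quotient_average:
  assumes s: "s \<in> {0..S}" and unit: "AE p in \<nu> s. p \<in> unit_pairs" and w: "continuous_on UNIV w"
  shows "(LINT (a, b)|\<nu> s. at_quotient w a b * (b + norm a)) = lift_average w s"
proof -
  have "(LINT p|\<nu> s. at_quotient w (fst p) (snd p) * (snd p + norm (fst p))) = lift_average w s"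
    unfolding lift_average_def
  proof (intro integral_cong_AE measurable_\<nu>[OF s] measurable_at_quotient[OF w] measurable_homogeneous_lift[OF w])
    show "AE p in \<nu> s. at_quotient w (fst p) (snd p) * (snd p + norm (fst p)) = homogeneous_lift w p"
      using unit
    proof eventually_elim
      case (elim p)
      then have "0 \<le> snd p" by (simp add: unit_pairs_def)
      from homogeneous_lift_at_quotient[OF w this, of "fst p"] show ?case by simp
    qed
  qed
  then show ?thesis by (simp add: case_prod_beta')
qed

lemma mu_integral_off_plateau:
  assumes t: "t \<in> {0..T}" "t \<notin> plateau_values" and unit: "AE p in \<nu> (first_time t). p \<in> unit_pairs"
    and w: "continuous_on UNIV w"
  shows "mu_integral S tt \<nu> t w = 1 / \<rho> (first_time t) * lift_average w (first_time t)"
proof -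
  let ?s = "first_time t"
  have single: "is_singleton (fibre t)" using t by (auto simp: plateau_values_def)
  have s: "?s \<in> {0..S}" "the_elem (fibre t) = ?s"
  proof -
    show "?s \<in> {0..S}" using first_time_in[OF t(1)] fibre_subset by blast
    show "the_elem (fibre t) = ?s" using first_time_in[OF t(1)] single by (auto simp: is_singleton_def)
  qed
  have "mu_integral S tt \<nu> t w = (LINT (a, b)|\<nu> ?s. 1 / \<rho> ?s * at_quotient w a b * (b + norm a))"
    using single s(2) by (simp add: mu_integral_def Let_def)
  also have "(\<lambda>(a, b). 1 / \<rho> ?s * at_quotient w a b * (b + norm a)) =
      (\<lambda>p. 1 / \<rho> ?s * (case p of (a, b) \<Rightarrow> at_quotient w a b * (b + norm a)))"
    by (auto simp: fun_eq_iff)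
  also have "integral\<^sup>L (\<nu> ?s) \<dots> = 1 / \<rho> ?s * (LINT (a, b)|\<nu> ?s. at_quotient w a b * (b + norm a))"
    by (rule integral_mult_right_zero)
  finally show ?thesis using at_quotient_average[OF s(1) unit w] by simp
qed

text \<open>The factor \<open>1 / \<rho> s\<close> disappears since \<open>\<rho> = 1\<close> almost everywhere on a plateau.\<close>

lemma mu_integral_plateau:
  assumes t: "t \<in> plateau_values" and w: "continuous_on UNIV w"
  shows "mu_integral S tt \<nu> t w = plateau_average w t"
proof -
  let ?f = "\<lambda>s. 1 / \<rho> s * (LINT (a, b)|\<nu> s. at_quotient w a b * (b + norm a))"
  have eq: "AE s in lebesgue_on (fibre t). lift_average w s = ?f s"
    using AE_plateau[OF t]
  proof eventually_elim
    case (elim s)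
    then have "AE p in \<nu> s. p \<in> unit_pairs" by (auto elim: eventually_mono)
    then show ?case using elim at_quotient_average[OF _ _ w, of s] by simp
  qed
  have m: "lift_average w \<in> borel_measurable (lebesgue_on (fibre t))"
    unfolding lebesgue_on_fibre by (rule measurable_restrict_space1[OF measurable_lift_average[OF w]])
  have "(LINT s|lebesgue_on (fibre t). ?f s) = (LINT s|lebesgue_on (fibre t). lift_average w s)"
  proof (rule integral_cong_AE[OF _ m])
    show "AE s in lebesgue_on (fibre t). ?f s = lift_average w s" using eq by eventually_elim simp
    have "(\<lambda>s. LINT p|\<nu> s. at_quotient w (fst p) (snd p) * (snd p + norm (fst p))) \<in> borel_measurable M"
      by (rule measurable_average[OF measurable_at_quotient[OF w]])
    then have "?f \<in> borel_measurable M" unfolding case_prod_beta' by measurable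
    then show "?f \<in> borel_measurable (lebesgue_on (fibre t))"
      unfolding lebesgue_on_fibre by (rule measurable_restrict_space1)
  qed
  moreover have "\<not> is_singleton (fibre t)" using t by (auto simp: plateau_values_def)
  ultimately show ?thesis by (simp add: mu_integral_def plateau_average_def)
qed

abbreviation angular_average :: "('k gammaR \<Rightarrow> real) \<Rightarrow> real \<Rightarrow> real" where
  "angular_average w \<equiv> fibrewise (plateau_average w) (\<lambda>s. 1 / \<rho> s * lift_average w s)"

lemma AE_mu_integral:
  "AE t in \<sigma>. \<forall>w. continuous_on UNIV w \<longrightarrow> mu_integral S tt \<nu> t w = angular_average w t"
  using AE_sigma_off_plateaus[OF AE_unit_pairs]
proof eventually_elim
  case (elim t)
  show ?case
  proof (intro allI impI)
    fix w :: "'k gammaR \<Rightarrow> real" assume w: "continuous_on UNIV w"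
    show "mu_integral S tt \<nu> t w = angular_average w t"
      using elim mu_integral_plateau[OF _ w] mu_integral_off_plateau[OF _ _ _ w]
      by (cases "t \<in> plateau_values") (auto simp: fibrewise_def)
  qed
qed

lemma measure_fibre_pos:
  assumes "t \<in> plateau_values" shows "0 < measure lebesgue (fibre t)"
proof -
  obtain c d where "fibre t = {c..d}" "c < d" using fibre_eq_interval[OF assms] by blast
  then show ?thesis by simp
qed

lemma finite_measure_fibre: "finite_measure (lebesgue_on (fibre t))"
proof -
  have "fibre t \<in> lmeasurable" using compact_fibre by (rule lmeasurable_compact)
  then show ?thesis
    by (intro finite_measureI) (auto simp: emeasure_restrict_space fmeasurable_def)
qed

lemma
  assumes t: "t \<in> plateau_values" and w: "continuous_on UNIV w" and C: "\<And>y. \<bar>w y\<bar> \<le> C"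
  shows integrable_plateau: "integrable (lebesgue_on (fibre t)) (lift_average w)"
    and plateau_average_bound: "\<bar>plateau_average w t\<bar> \<le> C * 2"
proof -
  interpret finite_measure "lebesgue_on (fibre t)" by (rule finite_measure_fibre)
  have b: "AE s in lebesgue_on (fibre t). \<bar>lift_average w s\<bar> \<le> C * 2"
    using AE_plateau[OF t]
  proof eventually_elim
    case (elim s)
    then have "AE p in \<nu> s. p \<in> unit_pairs" by (auto elim: eventually_mono)
    then show ?case using elim lift_average_bound[OF _ _ w C] by blast
  qed
  have m: "lift_average w \<in> borel_measurable (lebesgue_on (fibre t))"
    unfolding lebesgue_on_fibre by (rule measurable_restrict_space1[OF measurable_lift_average[OF w]])
  show int: "integrable (lebesgue_on (fibre t)) (lift_average w)"
    using b m by (intro integrable_const_bound[where B = "C * 2"]) auto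
  have "\<bar>LINT s|lebesgue_on (fibre t). lift_average w s\<bar> \<le> (LINT s|lebesgue_on (fibre t). \<bar>lift_average w s\<bar>)"
    by (rule integral_abs_bound)
  also have "\<dots> \<le> (LINT s|lebesgue_on (fibre t). C * 2)"
    using b int by (intro integral_mono_AE) auto
  also have "\<dots> = measure lebesgue (fibre t) * (C * 2)"
    using fibre_borel[of t] by (simp add: measure_restrict_space)
  finally show "\<bar>plateau_average w t\<bar> \<le> C * 2"
    using measure_fibre_pos[OF t] by (simp add: plateau_average_def abs_mult field_simps)
qed

lemma AE_lift_average_bounds:
  assumes w: "continuous_on UNIV w" and C: "\<And>y. \<bar>w y\<bar> \<le> C"
  shows "AE s in M. \<bar>lift_average w s\<bar> \<le> C * 2 \<and> \<bar>1 / \<rho> s * lift_average w s\<bar> \<le> C * 2"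
  using AE_M_unit_pairs
proof eventually_elim
  case (elim s)
  then have F: "\<bar>lift_average w s\<bar> \<le> C * 2" and r: "1 \<le> \<rho> s"
    using lift_average_bound[OF _ _ w C] rho_bounds by auto
  have "1 / \<rho> s * \<bar>lift_average w s\<bar> \<le> 1 * (C * 2)"
    using F r by (intro mult_mono) auto
  then show ?case using F r by (simp add: abs_mult)
qed

text \<open>Countably many plateaus allow to compare two integrals plateau by plateau.\<close>

lemma integral_over_plateaus:
  fixes f :: "real \<Rightarrow> real"
  assumes f: "integrable M f" and off: "AE s in M. tt s \<notin> plateau_values \<longrightarrow> f s = 0"
    and on: "\<And>t. t \<in> plateau_values \<Longrightarrow> (LINT s|lebesgue_on (fibre t). f s) = 0"
  shows "(LINT s|M. f s) = 0"
proof -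
  define A where "A i = (if i \<in> to_nat_on plateau_values ` plateau_values
    then fibre (from_nat_into plateau_values i) else {})" for i :: nat
  have A_sets: "A i \<in> sets M" for i using fibre_sets_M by (simp add: A_def)
  have A_Un: "(\<Union>i. A i) = {s \<in> {0..S}. tt s \<in> plateau_values}"
    using countable_plateau_values by (auto simp: A_def time_fibre_def split: if_splits)
  have disj: "A i \<inter> A j = {}" if "i \<noteq> j" for i j
    using that countable_plateau_values by (auto simp: A_def time_fibre_def split: if_splits)
  have UA: "(\<Union>i. A i) \<in> sets M" using A_sets by blast
  have sf: "set_integrable M (\<Union>i. A i) f"
    unfolding set_integrable_def using f UA by (rule integrable_mult_indicator[rotated])
  have zero: "(LINT s:A i|M. f s) = 0" for i
  proof (cases "i \<in> to_nat_on plateau_values ` plateau_values")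
    case True
    then obtain t where t: "t \<in> plateau_values" "A i = fibre t"
      using countable_plateau_values by (auto simp: A_def)
    have "(LINT s:A i|M. f s) = (LINT s|restrict_space M (fibre t). f s)"
      unfolding set_lebesgue_integral_def t(2) using fibre_sets_M[of t] fibre_subset[of t]
      by (subst integral_restrict_space) (auto simp: Int_absorb2)
    then show ?thesis using on[OF t(1)] by (simp add: lebesgue_on_fibre)
  qed (simp add: A_def set_lebesgue_integral_def)
  have "(LINT s|M. f s) = (LINT s:(\<Union>i. A i)|M. f s)"
    unfolding set_lebesgue_integral_def
  proof (rule integral_cong_AE)
    show "f \<in> borel_measurable M" using f by simp
    show "(\<lambda>s. indicator (\<Union>i. A i) s *\<^sub>R f s) \<in> borel_measurable M"
      using sf unfolding set_integrable_def by simp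
    show "AE s in M. f s = indicator (\<Union>i. A i) s *\<^sub>R f s"
      using off AE_space by eventually_elim (auto simp: A_Un indicator_def)
  qed
  also have "\<dots> = (\<Sum>i. (LINT s:A i|M. f s))"
    by (rule lebesgue_integral_countable_add[OF A_sets disj sf])
  also have "\<dots> = 0" by (simp add: zero)
  finally show ?thesis .
qed

text \<open>
  Off the plateaus the density \<open>\<rho>\<close> of \<open>\<sigma>\<close> cancels \<open>1 / \<rho>\<close> pointwise. On a plateau, where \<open>\<rho> = 1\<close> and \<open>g (tt s)\<close>
  is constant, the average of the lift times the length of the plateau is its integral.
\<close>

lemma angular_average_sigma:
  assumes g: "continuous_on {0..T} g" and w: "continuous_on UNIV w"
  shows "angular_average w \<in> borel_measurable (completion \<sigma>)"
    and "integrable (completion \<sigma>) (\<lambda>t. g t * angular_average w t)"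
    and "(LINT t|completion \<sigma>. g t * angular_average w t) = (LINT s|M. g (tt s) * lift_average w s)"
proof -
  obtain C where C: "0 \<le> C" "\<And>y. \<bar>w y\<bar> \<le> C" using continuous_gammaR_bounded[OF w] by blast
  have "compact (g ` {0..T})" by (intro compact_continuous_image g) auto
  then obtain B where B: "\<And>t. t \<in> {0..T} \<Longrightarrow> \<bar>g t\<bar> \<le> B"
    using compact_imp_bounded by (force simp: bounded_iff)
  have B0: "0 \<le> B" using B[of 0] T_pos by auto
  let ?G = "\<lambda>s. 1 / \<rho> s * lift_average w s"
  note AEb = AE_lift_average_bounds[OF w C(2)]
  have mF [measurable]: "lift_average w \<in> borel_measurable M" by (rule measurable_lift_average[OF w])
  have mG: "?G \<in> borel_measurable M" by measurable
  have AEG: "AE s in M. \<bar>?G s\<bar> \<le> C * 2" using AEb by eventually_elim simp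
  show meas: "angular_average w \<in> borel_measurable (completion \<sigma>)"
    by (rule fibrewise_sigma(1)[OF mG AEG]) (rule plateau_average_bound[OF _ w C(2)])
  have mgt [measurable]: "(\<lambda>s. g (tt s)) \<in> borel_measurable M"
    using tt_in by (intro continuous_measurable_lebesgue_on continuous_on_compose2[OF g tt_continuous]) auto
  let ?c = "\<lambda>t. g t * plateau_average w t"
  let ?gG = "\<lambda>s. g (tt s) * ?G s"
  have mgG: "?gG \<in> borel_measurable M" by measurable
  have AEgG: "AE s in M. \<bar>?gG s\<bar> \<le> B * (C * 2)"
    using AEG AE_space
  proof eventually_elim
    case (elim s)
    have "\<bar>g (tt s)\<bar> * \<bar>?G s\<bar> \<le> B * (C * 2)"
      using elim B[OF tt_in, of s] B0 by (intro mult_mono) auto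
    then show ?case by (simp add: abs_mult)
  qed
  have c_bound: "\<bar>?c t\<bar> \<le> B * (C * 2)" if "t \<in> plateau_values" for t
    unfolding abs_mult using that B[of t] B0 plateau_average_bound[OF that w C(2)]
    by (intro mult_mono) (auto simp: plateau_values_def)
  note sigma = fibrewise_sigma[OF mgG AEgG c_bound]
  have eq: "g t * angular_average w t = fibrewise ?c ?gG t" if "t \<in> space (completion \<sigma>)" for t
    using that first_time_in[of t] by (auto simp: fibrewise_def space_sigma time_fibre_def)
  show "integrable (completion \<sigma>) (\<lambda>t. g t * angular_average w t)"
    using sigma(2) by (subst Bochner_Integration.integrable_cong[OF refl eq])
  let ?h = "\<lambda>s. \<rho> s * (if tt s \<in> plateau_values then ?c (tt s) else ?gG s)"
  let ?f = "\<lambda>s. ?h s - g (tt s) * lift_average w s"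
  have AEh: "AE s in M. \<bar>?h s\<bar> \<le> 2 * (B * (C * 2))"
    using AEgG AE_rho_bounds AE_space
  proof eventually_elim
    case (elim s)
    have "\<bar>\<rho> s\<bar> * \<bar>if tt s \<in> plateau_values then ?c (tt s) else ?gG s\<bar> \<le> 2 * (B * (C * 2))"
      using elim c_bound[of "tt s"] by (intro mult_mono) auto
    then show ?case by (simp add: abs_mult)
  qed
  have int_h: "integrable M ?h" by (rule integrable_lebesgue_on_bounded[OF sigma(4) AEh])
  have int_gF: "integrable M (\<lambda>s. g (tt s) * lift_average w s)"
  proof (rule integrable_lebesgue_on_bounded)
    show "AE s in M. \<bar>g (tt s) * lift_average w s\<bar> \<le> B * (C * 2)"
      using AEb AE_space
    proof eventually_elim
      case (elim s)
      have "\<bar>g (tt s)\<bar> * \<bar>lift_average w s\<bar> \<le> B * (C * 2)"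
        using elim B[OF tt_in, of s] B0 by (intro mult_mono) auto
      then show ?case by (simp add: abs_mult)
    qed
  qed measurable
  have "(LINT s|M. ?f s) = 0"
  proof (rule integral_over_plateaus)
    show "integrable M ?f" using int_h int_gF by (rule Bochner_Integration.integrable_diff)
    show "AE s in M. tt s \<notin> plateau_values \<longrightarrow> ?f s = 0"
      using AE_rho_bounds by eventually_elim auto
    fix t assume t: "t \<in> plateau_values"
    interpret finite_measure "lebesgue_on (fibre t)" by (rule finite_measure_fibre)
    note int_F = integrable_plateau[OF t w C(2)]
    let ?k = "\<lambda>s. g t * (plateau_average w t - lift_average w s)"
    have "(LINT s|lebesgue_on (fibre t). ?f s) = (LINT s|lebesgue_on (fibre t). ?k s)"
    proof (rule integral_cong_AE)
      have "?f \<in> borel_measurable M" using int_h int_gF by (intro borel_measurable_diff) auto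
      then show "?f \<in> borel_measurable (lebesgue_on (fibre t))"
        unfolding lebesgue_on_fibre by (rule measurable_restrict_space1)
      show "?k \<in> borel_measurable (lebesgue_on (fibre t))" using int_F by auto
      show "AE s in lebesgue_on (fibre t). ?f s = ?k s"
        using AE_plateau[OF t] AE_space
        by eventually_elim (use t in \<open>auto simp: time_fibre_def algebra_simps\<close>)
    qed
    also have "\<dots> = g t * (measure lebesgue (fibre t) * plateau_average w t - (LINT s|lebesgue_on (fibre t). lift_average w s))"
      using int_F fibre_borel[of t] by (simp add: measure_restrict_space)
    also have "\<dots> = 0" using measure_fibre_pos[OF t] by (simp add: plateau_average_def)
    finally show "(LINT s|lebesgue_on (fibre t). ?f s) = 0" .
  qed
  then have "(LINT s|M. ?h s) = (LINT s|M. g (tt s) * lift_average w s)"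
    using int_h int_gF by simp
  moreover have "(LINT t|completion \<sigma>. g t * angular_average w t) = (LINT t|completion \<sigma>. fibrewise ?c ?gG t)"
    by (rule Bochner_Integration.integral_cong[OF refl eq])
  ultimately show "(LINT t|completion \<sigma>. g t * angular_average w t) = (LINT s|M. g (tt s) * lift_average w s)"
    using sigma(3) by simp
qed

text \<open>
  The angular measures are prescribed almost everywhere only, so their integrals inherit measurability
  from \<open>angular_average\<close> through completeness.
\<close>

lemma is_mu_of_imp:
  assumes \<mu>: "is_mu_of T S tt \<nu> \<mu>"
  shows "diperna_majda_measure T \<sigma> \<mu>"
    and "\<And>g w. continuous_on {0..T} g \<Longrightarrow> continuous_on UNIV w \<Longrightarrow>
      integrable (completion \<sigma>) (\<lambda>t. g t * (LINT y|\<mu> t. w y)) \<and>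
      (LINT t|completion \<sigma>. g t * (LINT y|\<mu> t. w y)) = (LINT s|M. g (tt s) * lift_average w s)"
proof -
  have eq: "AE t in completion \<sigma>. angular_average w t = (LINT y|\<mu> t. w y)" if "continuous_on UNIV w" for w :: "'k gammaR \<Rightarrow> real"
  proof -
    have "AE t in \<sigma>. \<forall>w. continuous_on UNIV w \<longrightarrow> (LINT y|\<mu> t. w y) = mu_integral S tt \<nu> t w"
      using \<mu> by (simp add: is_mu_of_def)
    with AE_mu_integral have "AE t in \<sigma>. angular_average w t = (LINT y|\<mu> t. w y)"
      by eventually_elim (use that in auto)
    then show ?thesis by (rule AE_completion)
  qed
  have meas: "(\<lambda>t. LINT y|\<mu> t. w y) \<in> borel_measurable (completion \<sigma>)" if w: "continuous_on UNIV w" for w :: "'k gammaR \<Rightarrow> real"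
    by (rule completion.borel_measurable_AE_cong[OF angular_average_sigma(1)[OF continuous_on_const w] eq[OF w]])
  show "diperna_majda_measure T \<sigma> \<mu>"
    using \<mu> meas finite_measure_sigma sets_sigma by (auto simp: diperna_majda_measure_def is_mu_of_def)
  fix g :: "real \<Rightarrow> real" and w :: "'k gammaR \<Rightarrow> real"
  assume g: "continuous_on {0..T} g" and w: "continuous_on UNIV w"
  note avg = angular_average_sigma[OF g w]
  have "g \<in> borel_measurable \<sigma>"
    using borel_measurable_continuous_on_restrict[OF g] measurable_cong_sets[OF sets_sigma refl] by blast
  then have mg: "(\<lambda>t. g t * (LINT y|\<mu> t. w y)) \<in> borel_measurable (completion \<sigma>)"
    by (intro borel_measurable_times meas[OF w] measurable_completion)
  have eqg: "AE t in completion \<sigma>. g t * angular_average w t = g t * (LINT y|\<mu> t. w y)"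
    using eq[OF w] by eventually_elim simp
  show "integrable (completion \<sigma>) (\<lambda>t. g t * (LINT y|\<mu> t. w y)) \<and>
      (LINT t|completion \<sigma>. g t * (LINT y|\<mu> t. w y)) = (LINT s|M. g (tt s) * lift_average w s)"
    using integrable_cong_AE[OF borel_measurable_integrable[OF avg(2)] mg eqg]
      integral_cong_AE[OF borel_measurable_integrable[OF avg(2)] mg eqg] avg(2,3) by simp
qed

section \<open>Construction of the angular measures\<close>

text \<open>
  The measure \<open>\<mu>\<^sub>t\<close> is the law of the quotient point under \<open>\<nu> s\<close> weighted by \<open>(|a| + b) / \<rho> s\<close>. On a plateau the
  weight \<open>|a| + b\<close> is one, so there it is the law of the quotient point when \<open>s\<close> is
  chosen uniformly on the plateau and then \<open>(a, b)\<close> according to \<open>\<nu> s\<close>.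
\<close>

definition point_law :: "real \<Rightarrow> 'k gammaR measure" where
  "point_law s = distr (density (\<nu> s) (\<lambda>p. ennreal (cone_size p / \<rho> s))) borel quotient_point"

definition plateau_law :: "real \<Rightarrow> 'k gammaR measure" where
  "plateau_law t =
     distr (density (lebesgue_on (fibre t)) (\<lambda>_. ennreal (1 / measure lebesgue (fibre t))) \<bind> \<nu>) borel quotient_point"

lemma point_law:
  assumes s: "s \<in> {0..S}" and unit: "AE p in \<nu> s. p \<in> unit_pairs"
  shows "finite_measure (point_law s)"
    and "continuous_on UNIV w \<Longrightarrow> (LINT y|point_law s. w y) = 1 / \<rho> s * lift_average w s"
proof -
  interpret prob_space "\<nu> s" by (rule prob_space_\<nu>[OF s])
  have sets_d: "sets (density (\<nu> s) (\<lambda>p. ennreal (cone_size p / \<rho> s))) = sets borel"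
    by (simp add: sets_\<nu>[OF s])
  have q: "quotient_point \<in> density (\<nu> s) (\<lambda>p. ennreal (cone_size p / \<rho> s)) \<rightarrow>\<^sub>M borel"
    by (subst measurable_cong_sets[OF sets_d refl]) (rule measurable_quotient_point)
  have mc: "(\<lambda>p. cone_size p / \<rho> s) \<in> borel_measurable (\<nu> s)"
    by (rule measurable_\<nu>[OF s]) measurable
  have r: "1 \<le> \<rho> s" by (rule rho_bounds[OF s unit])
  have "emeasure (density (\<nu> s) (\<lambda>p. ennreal (cone_size p / \<rho> s))) (space (\<nu> s)) =
      (\<integral>\<^sup>+p. ennreal (cone_size p / \<rho> s) * indicator (space (\<nu> s)) p \<partial>\<nu> s)"
    using mc by (intro emeasure_density) auto
  also have "\<dots> \<le> (\<integral>\<^sup>+p. 2 \<partial>\<nu> s)"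
  proof (rule nn_integral_mono_AE)
    show "AE p in \<nu> s. ennreal (cone_size p / \<rho> s) * indicator (space (\<nu> s)) p \<le> 2"
      using unit
    proof eventually_elim
      case (elim p)
      have "cone_size p / \<rho> s \<le> 2 / 1" using cone_size_unit_pairs[OF elim] r by (intro frac_le) auto
      then show ?case using ennreal_leI[of "cone_size p / \<rho> s" 2] by (simp add: indicator_def)
    qed
  qed
  also have "\<dots> < \<infinity>" by (simp add: emeasure_space_1)
  finally have "finite_measure (density (\<nu> s) (\<lambda>p. ennreal (cone_size p / \<rho> s)))"
    by (intro finite_measureI) simp
  then show "finite_measure (point_law s)"
    unfolding point_law_def using q by (rule finite_measure.finite_measure_distr)
  assume w: "continuous_on UNIV w"
  have mw: "(\<lambda>p. w (quotient_point p)) \<in> borel_measurable (\<nu> s)"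
    by (intro measurable_\<nu>[OF s] measurable_compose[OF measurable_quotient_point measurable_gammaR_continuous[OF w]])
  have "(LINT y|point_law s. w y) =
      (LINT p|density (\<nu> s) (\<lambda>p. ennreal (cone_size p / \<rho> s)). w (quotient_point p))"
    unfolding point_law_def by (rule integral_distr[OF q measurable_gammaR_continuous[OF w]])
  also have "\<dots> = (LINT p|\<nu> s. (cone_size p / \<rho> s) *\<^sub>R w (quotient_point p))"
    using r by (intro integral_density mw mc) auto
  also have "\<dots> = (LINT p|\<nu> s. 1 / \<rho> s * homogeneous_lift w p)"
    by (simp add: homogeneous_lift_def)
  also have "\<dots> = 1 / \<rho> s * lift_average w s"
    unfolding lift_average_def by (rule integral_mult_right_zero)
  finally show "(LINT y|point_law s. w y) = 1 / \<rho> s * lift_average w s" .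
qed

lemma plateau_law:
  assumes t: "t \<in> plateau_values"
  shows "finite_measure (plateau_law t)"
    and "continuous_on UNIV w \<Longrightarrow> (LINT y|plateau_law t. w y) = plateau_average w t"
proof -
  let ?m = "measure lebesgue (fibre t)"
  define U where "U = density (lebesgue_on (fibre t)) (\<lambda>_. ennreal (1 / ?m))"
  have m: "0 < ?m" by (rule measure_fibre_pos[OF t])
  interpret F: finite_measure "lebesgue_on (fibre t)" by (rule finite_measure_fibre)
  have space_U: "space U = fibre t" by (simp add: U_def)
  have emeasure_fibre: "emeasure (lebesgue_on (fibre t)) (fibre t) = ennreal ?m"
    using fibre_borel[of t] F.emeasure_eq_measure[of "fibre t"] by (simp add: measure_restrict_space)
  have "emeasure U (space U) = 1"
    using m sets.top[of "lebesgue_on (fibre t)"]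
    by (simp add: space_U) (simp add: U_def emeasure_density_const emeasure_fibre ennreal_mult'[symmetric])
  then interpret U: prob_space U by (rule prob_spaceI)
  have "\<nu> \<in> lebesgue_on (fibre t) \<rightarrow>\<^sub>M subprob_algebra borel"
    unfolding lebesgue_on_fibre by (rule measurable_restrict_space1[OF \<nu>_measurable])
  then have \<nu>U: "\<nu> \<in> U \<rightarrow>\<^sub>M subprob_algebra borel" by (simp add: U_def)
  have ne: "space U \<noteq> {}" by (rule U.not_empty)
  have sets_bind_U: "sets (U \<bind> \<nu>) = sets borel"
    by (rule sets_bind[OF _ ne]) (use sets_\<nu> fibre_subset[of t] in \<open>auto simp: space_U\<close>)
  have q: "quotient_point \<in> (U \<bind> \<nu>) \<rightarrow>\<^sub>M borel"
    using measurable_quotient_point measurable_cong_sets[OF sets_bind_U refl] by blast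
  have "subprob_space (U \<bind> \<nu>)"
    by (rule subprob_space_bind[OF U.subprob_space_axioms \<nu>U])
  then have "finite_measure (U \<bind> \<nu>)" by (simp add: subprob_space.axioms(1))
  then show "finite_measure (plateau_law t)"
    unfolding plateau_law_def U_def[symmetric] using q by (rule finite_measure.finite_measure_distr)
  assume w: "continuous_on UNIV w"
  obtain C where C: "\<And>y. \<bar>w y\<bar> \<le> C" using continuous_gammaR_bounded[OF w] by blast
  let ?wq = "\<lambda>p. w (quotient_point p)"
  have mw: "?wq \<in> borel_measurable borel"
    by (intro measurable_compose[OF measurable_quotient_point measurable_gammaR_continuous[OF w]])
  have mavg: "(\<lambda>s. LINT p|\<nu> s. ?wq p) \<in> borel_measurable (lebesgue_on (fibre t))"
    unfolding lebesgue_on_fibre by (rule measurable_restrict_space1[OF measurable_average[OF mw]])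
  have "(LINT y|plateau_law t. w y) = (LINT p|(U \<bind> \<nu>). ?wq p)"
    unfolding plateau_law_def U_def[symmetric] by (rule integral_distr[OF q measurable_gammaR_continuous[OF w]])
  also have "\<dots> = (LINT s|U. LINT p|\<nu> s. ?wq p)"
  proof (rule integral_bind[OF mw _ \<nu>U U.finite_measure_axioms, of C 1])
    show "AE s in U. emeasure (\<nu> s) (space (\<nu> s)) \<le> ennreal 1"
      using AE_space
    proof eventually_elim
      case (elim s)
      then have "prob_space (\<nu> s)" using prob_space_\<nu> fibre_subset[of t] by (auto simp: space_U)
      then show ?case by (simp add: prob_space.emeasure_space_1)
    qed
  qed (rule C)
  also have "\<dots> = (LINT s|lebesgue_on (fibre t). (1 / ?m) *\<^sub>R (LINT p|\<nu> s. ?wq p))"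
    unfolding U_def using m by (intro integral_density mavg) auto
  also have "\<dots> = 1 / ?m * (LINT s|lebesgue_on (fibre t). LINT p|\<nu> s. ?wq p)"
    by simp
  also have "(LINT s|lebesgue_on (fibre t). LINT p|\<nu> s. ?wq p) = (LINT s|lebesgue_on (fibre t). lift_average w s)"
  proof (rule integral_cong_AE[OF mavg])
    show "lift_average w \<in> borel_measurable (lebesgue_on (fibre t))"
      using integrable_plateau[OF t w C] by simp
    show "AE s in lebesgue_on (fibre t). (LINT p|\<nu> s. ?wq p) = lift_average w s"
      using AE_plateau[OF t]
    proof eventually_elim
      case (elim s)
      then have s: "s \<in> {0..S}" and one: "AE p in \<nu> s. p \<in> unit_pairs \<and> cone_size p = 1" by auto
      show ?case
        unfolding lift_average_def
      proof (intro integral_cong_AE measurable_\<nu>[OF s] mw measurable_homogeneous_lift[OF w])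
        show "AE p in \<nu> s. ?wq p = homogeneous_lift w p"
          using one by eventually_elim (simp add: homogeneous_lift_def)
      qed
    qed
  qed
  finally show "(LINT y|plateau_law t. w y) = plateau_average w t" by (simp add: plateau_average_def)
qed

lemma ex_is_mu_of: "\<exists>\<mu>. is_mu_of T S tt \<nu> \<mu>"
proof -
  define regular where "regular t \<longleftrightarrow> (AE p in \<nu> (first_time t). p \<in> unit_pairs)" for t
  define \<mu> where "\<mu> t = (if t \<in> plateau_values then plateau_law t
    else if regular t then point_law (first_time t) else null_measure borel)" for t
  have first: "first_time t \<in> {0..S}" if "t \<in> {0..T}" for t
    using first_time_in[OF that] fibre_subset by blast
  have "radon_family T \<mu>"
    unfolding radon_family_def
  proof (intro ballI conjI)
    fix t assume t: "t \<in> {0..T}"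
    show "sets (\<mu> t) = sets borel" by (simp add: \<mu>_def plateau_law_def point_law_def)
    show "finite_measure (\<mu> t)"
      using plateau_law(1)[of t] point_law(1)[OF first[OF t]]
      by (auto simp: \<mu>_def regular_def intro: finite_measureI)
  qed
  moreover have "AE t in \<sigma>. \<forall>w. continuous_on UNIV w \<longrightarrow> (LINT y|\<mu> t. w y) = mu_integral S tt \<nu> t w"
    using AE_mu_integral AE_sigma_off_plateaus[OF AE_unit_pairs]
  proof eventually_elim
    case (elim t)
    show ?case
    proof (intro allI impI)
      fix w :: "'k gammaR \<Rightarrow> real" assume w: "continuous_on UNIV w"
      have "(LINT y|\<mu> t. w y) = angular_average w t"
        using elim(2) plateau_law(2)[OF _ w, of t] point_law(2)[OF first _ w, of t]
        by (cases "t \<in> plateau_values") (auto simp: \<mu>_def fibrewise_def regular_def)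
      then show "(LINT y|\<mu> t. w y) = mu_integral S tt \<nu> t w" using elim(1) w by simp
    qed
  qed
  ultimately show ?thesis unfolding is_mu_of_def by blast
qed

end

section \<open>Generation of the DiPerna-Majda measure\<close>

theorem proposition4p17:
  fixes T S :: real
    and u :: "nat \<Rightarrow> real \<Rightarrow> real^'k::finite"
    and Sj :: "nat \<Rightarrow> real"
    and tj vj :: "nat \<Rightarrow> real \<Rightarrow> real"
    and uj :: "nat \<Rightarrow> real \<Rightarrow> real^'k"
    and tt :: "real \<Rightarrow> real"
    and \<nu> :: "real \<Rightarrow> ((real^'k) \<times> real) measure"
  assumes "0 < T"
    and "\<And>j. integrable (lebesgue_on {0..T}) (u j)"
    and "\<exists>C. \<forall>j. (LINT t|lebesgue_on {0..T}. norm (u j t)) \<le> C"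
    and "\<And>j. normalized_vertical_relaxation T (u j) (Sj j) (tj j) (vj j) (uj j)"
    and "Sj \<longlonglongrightarrow> S"
    and "uniform_limit {0..S} (\<lambda>j. extend_by T (Sj j) (tj j)) tt sequentially"
    and "young_measure S \<nu>"
    and "generates_young S (\<lambda>j. extend_by 0 (Sj j) (vj j)) (\<lambda>j. extend_by 0 (Sj j) (uj j)) \<nu>"
  shows "(\<exists>\<mu>. is_mu_of T S tt \<nu> \<mu>) \<and>
         (\<forall>\<mu>. is_mu_of T S tt \<nu> \<mu> \<longrightarrow>
            generates_diperna_majda T u (sigma_of T S tt \<nu>) \<mu>)"
proof -
  interpret Y: young_family S \<nu> by unfold_locales fact
  interpret R: relaxation_sequence S \<nu> T u Sj tj vj uj tt
    by unfold_locales (use assms in auto)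
  interpret P: parametrized_young S \<nu> T tt
  proof unfold_locales
    show "0 < T" by fact
    show "0 < S" using R.T_le_S \<open>0 < T\<close> by linarith
    show "tt 0 = 0" "tt S = T" by (rule R.tt_0 R.tt_S)+
    show "\<And>x y. x \<in> {0..S} \<Longrightarrow> y \<in> {0..S} \<Longrightarrow> x \<le> y \<Longrightarrow> tt x \<le> tt y" by (rule R.tt_mono)
    show "continuous_on {0..S} tt" by (rule lipschitz_on_continuous_on[OF R.tt_lipschitz])
    show "AE s in lebesgue_on {0..S}. AE p in \<nu> s. p \<in> unit_pairs" by (rule R.AE_\<nu>_unit_pairs)
    show "\<And>c d. 0 \<le> c \<Longrightarrow> c < d \<Longrightarrow> d \<le> S \<Longrightarrow> tt c = tt d \<Longrightarrow>
        AE s in lebesgue_on {0..S}. s \<in> {c..d} \<longrightarrow> (AE p in \<nu> s. snd p = 0)" by (rule R.plateau_vertical)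
  qed
  show ?thesis
  proof (intro conjI allI impI)
    show "\<exists>\<mu>. is_mu_of T S tt \<nu> \<mu>" by (rule P.ex_is_mu_of)
    fix \<mu> assume \<mu>: "is_mu_of T S tt \<nu> \<mu>"
    show "generates_diperna_majda T u (sigma_of T S tt \<nu>) \<mu>"
      unfolding generates_diperna_majda_def
    proof (intro conjI allI impI)
      show "diperna_majda_measure T (sigma_of T S tt \<nu>) \<mu>" by (rule P.is_mu_of_imp(1)[OF \<mu>])
      fix g :: "real \<Rightarrow> real" and w :: "'k gammaR \<Rightarrow> real"
      assume g: "continuous_on {0..T} g" and w: "continuous_on UNIV w"
      note lim = P.is_mu_of_imp(2)[OF \<mu> g w]
      show "integrable (completion (sigma_of T S tt \<nu>)) (\<lambda>t. g t * (LINT y|\<mu> t. w y))"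
        using lim by blast
      show "(\<lambda>j. LINT t|lebesgue_on {0..T}. g t * w (Fin (u j t)) * (1 + norm (u j t))) \<longlonglongrightarrow>
          (LINT t|completion (sigma_of T S tt \<nu>). g t * (LINT y|\<mu> t. w y))"
        using R.energy_limit[OF assms(2) g w] lim by (simp add: P.lift_average_def)
    qed
  qed
qed

end
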